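(* Let $p$ be a prime with $p\equiv3\pmod4$ and $q=p^2$. Let $A(q)$ be the adjacency matrix of the Paley graph $\mathrm{Paley}(q)$ and $A^*(q)$ that of the Peisert graph $P^*(q)$, with respect to the same ordering of their common vertex set $\mathbb{F}_q$. Then (i) there is a number field whose ring of algebraic integers $D$ is such that $A(q)$ and $A^*(q)$ are similar over $D$, i.e. $CA(q)C^{-1}=A^*(q)$ for some matrix $C$ invertible over $D$; (ii) $A(q)$ and $A^*(q)$ are similar over the local ring $\mathbb{Z}_{(\ell)}$ for every prime $\ell\in\mathbb{Z}$.
   Context: $\mathrm{Paley}(q)$ has vertex set $\mathbb{F}_q$, distinct $x,y$ adjacent iff $x-y$ is a nonzero square. With $\beta$ a primitive element of $\mathbb{F}_q$, $C_0$ the subgroup of nonzero fourth powers in $\mathbb{F}_q^\times$ and $S'=C_0\cup\beta C_0$, $P^*(q)$ has vertex set $\mathbb{F}_q$, distinct $x,y$ adjacent iff $x-y\in S'$. Two $n\times n$ matrices over an integral domain $D$ are similar over $D$ if $CAC^{-1}=B$ for some $C$ invertible in the ring of $n\times n$ matrices over $D$. *)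

theory Defs
  imports "HOL-Analysis.Analysis" "HOL-Computational_Algebra.Polynomial"
begin

definition paley_adj :: "'a::field \<Rightarrow> 'a \<Rightarrow> bool" where
  "paley_adj x y \<longleftrightarrow> x \<noteq> y \<and> x - y \<in> {z ^ 2 |z. z \<noteq> 0}"

definition primitive_element :: "'a::field \<Rightarrow> bool" where
  "primitive_element b \<longleftrightarrow> {b ^ k |k::nat. True} = UNIV - {0}"

definition fourth_powers :: "'a::field set" where
  "fourth_powers = {z ^ 4 |z. z \<noteq> 0}"

definition peisert_adj :: "'a::field \<Rightarrow> 'a \<Rightarrow> 'a \<Rightarrow> bool" where
  "peisert_adj b x y \<longleftrightarrow>
     x \<noteq> y \<and> x - y \<in> fourth_powers \<union> (\<lambda>c. b * c) ` fourth_powers"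

(* Rows and columns are indexed by the vertices themselves, so adjacency matrices of two graphs
   on the same vertex type automatically refer to the same ordering of the vertices. *)
definition adjacency_matrix :: "('a::finite \<Rightarrow> 'a \<Rightarrow> bool) \<Rightarrow> 'b::zero_neq_one ^ 'a ^ 'a" where
  "adjacency_matrix E = (\<chi> x y. if E x y then 1 else 0)"

definition matrices_over :: "'b set \<Rightarrow> ('b ^ 'n ^ 'n) set" where
  "matrices_over D = {M. \<forall>i j. M $ i $ j \<in> D}"

(* D is meant to be (the carrier of) a subring of the ambient field. The matrix C' is the inverse
   of C and is required to have its entries in D as well: C is invertible over D, not merely
   over the ambient field. *)
definition similar_over :: "'b::field set \<Rightarrow> 'b ^ 'n ^ 'n \<Rightarrow> 'b ^ 'n ^ 'n \<Rightarrow> bool" where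
  "similar_over D A B \<longleftrightarrow> A \<in> matrices_over D \<and> B \<in> matrices_over D \<and>
     (\<exists>C\<in>matrices_over D. \<exists>C'\<in>matrices_over D.
        C ** C' = mat 1 \<and> C' ** C = mat 1 \<and> C ** A ** C' = B)"

(* Number fields are taken as subfields of the complex numbers of finite degree over the
   rationals; every abstract number field embeds into the complex numbers. *)
definition number_field :: "complex set \<Rightarrow> bool" where
  "number_field K \<longleftrightarrow>
     0 \<in> K \<and> 1 \<in> K \<and>
     (\<forall>x\<in>K. \<forall>y\<in>K. x + y \<in> K \<and> x * y \<in> K) \<and>
     (\<forall>x\<in>K. - x \<in> K \<and> inverse x \<in> K) \<and>
     (\<exists>S. finite S \<and> module.span (\<lambda>(r::rat) z. of_rat r * z) S = K)"

definition ring_of_integers :: "complex set \<Rightarrow> complex set" where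
  "ring_of_integers K = {x \<in> K. algebraic_int x}"

definition localized_integers :: "nat \<Rightarrow> rat set" where
  "localized_integers l = {of_int a / of_int b |a b :: int. \<not> int l dvd b}"

end

theory Submission
  imports Defs "HOL-Computational_Algebra.Primes"
begin

text \<open>
  Both graphs are nets: since \<open>4\<close> divides \<open>p + 1\<close>, every nonzero element of the prime field is a
  fourth power, so adjacency of \<open>x\<close> and \<open>y\<close> only depends on the slope \<open>(x - y) ^ (p - 1)\<close>, which has to
  lie in a set \<open>\<Theta>\<close> of \<open>m = (p + 1) / 2\<close> of the \<open>p + 1\<close> slopes of the affine plane of order \<open>p\<close>.
  We show that the integral similarity class does not depend on \<open>\<Theta>\<close>; hence the rational numbers serve as
  number field, and all local rings are covered at the same time.

  Up to multiples of the identity and of the all-one matrix, such a graph is a matrix \<open>T\<close> with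
  eigenvalues \<open>0\<close> and \<open>p\<close> on the vectors of sum zero. Its rank modulo \<open>p\<close> is \<open>m ^ 2\<close>: as
  the indicator function of the line of slope \<open>t\<close> through \<open>0\<close> is \<open>1 + t (z ^ p - t z) ^ (p - 1)\<close>, the
  reduction of \<open>T\<close> decomposes into Hankel matrices of full rank. Linear algebra modulo \<open>p\<close> then gives
  a family \<open>w, T w, 1, y\<^sub>i, T y\<^sub>i, k\<^sub>j, l\<^sub>j\<close> of integral vectors with \<open>T k\<^sub>j = 0\<close> and
  \<open>T l\<^sub>j = p l\<^sub>j\<close> whose index in the lattice of all integral vectors is prime to \<open>p\<close>. Away from \<open>p\<close> the
  lattice splits into eigenspaces, and since there is at least one \<open>k\<^sub>j\<close> and one \<open>l\<^sub>j\<close> to absorb a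
  new vector, the family can be enlarged step by step to a basis without changing its shape. The
  matrix of \<open>T\<close> in such a basis depends on \<open>p\<close> only.
\<close>

section \<open>Integral spans and enlargement of adapted families\<close>

text \<open>Indexed by labels rather than by a set of vectors, so that matrices with these columns
  can be formed later. For finite \<open>I\<close> it is the lattice generated by the
  family.\<close>

definition int_span :: "('i \<Rightarrow> int ^ 'n) \<Rightarrow> 'i set \<Rightarrow> (int ^ 'n) set" where
  "int_span F I = {\<Sum>i\<in>I. x i *s F i |x. True}"

lemma int_spanI: "(\<Sum>i\<in>I. x i *s F i) \<in> int_span F I"
  unfolding int_span_def by blast

lemma int_span_add: "u \<in> int_span F I \<Longrightarrow> v \<in> int_span F I \<Longrightarrow> u + v \<in> int_span F I"
proof -
  assume "u \<in> int_span F I" and "v \<in> int_span F I"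
  then obtain x y where "u = (\<Sum>i\<in>I. x i *s F i)" "v = (\<Sum>i\<in>I. y i *s F i)"
    unfolding int_span_def by blast
  then have "u + v = (\<Sum>i\<in>I. (x i + y i) *s F i)"
    by (simp add: sum.distrib vector_sadd_rdistrib)
  then show ?thesis by (metis int_spanI)
qed

lemma int_span_smult: "u \<in> int_span F I \<Longrightarrow> c *s u \<in> int_span F I"
proof -
  assume "u \<in> int_span F I"
  then obtain x where u: "u = (\<Sum>i\<in>I. x i *s F i)" unfolding int_span_def by blast
  have "c *s u = (\<Sum>i\<in>I. (c * x i) *s F i)"
    unfolding u by (simp add: vec_eq_iff sum_distrib_left mult.assoc)
  then show ?thesis by (metis int_spanI)
qed

lemma int_span_zero: "0 \<in> int_span F I"
  using int_spanI[where x = "\<lambda>_. 0"] by simp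

lemma int_span_diff: "u \<in> int_span F I \<Longrightarrow> v \<in> int_span F I \<Longrightarrow> u - v \<in> int_span F I"
  using int_span_add[of u F I "(-1) *s v"] int_span_smult[of v F I "-1"]
  by (simp flip: vector_sneg_minus1)

lemma int_span_sum: "(\<And>i. i \<in> J \<Longrightarrow> u i \<in> int_span F I) \<Longrightarrow> (\<Sum>i\<in>J. u i) \<in> int_span F I"
  by (induction J rule: infinite_finite_induct) (auto intro: int_span_add int_span_zero)

lemma int_span_base:
  assumes "finite I" "i \<in> I"
  shows "F i \<in> int_span F I"
proof -
  have "F i = (\<Sum>j\<in>I. (if j = i then 1 else 0) *s F j)"
    using assms by (simp add: if_distrib[where f = "\<lambda>c. c *s _"] sum.delta cong: if_cong)
  then show ?thesis by (metis int_spanI)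
qed

lemma int_span_subset:
  assumes "\<And>i. i \<in> I \<Longrightarrow> F i \<in> int_span G J"
  shows "int_span F I \<subseteq> int_span G J"
  using assms unfolding int_span_def[of F I] by (auto intro!: int_span_sum int_span_smult)

text \<open>With \<open>s * a + t * b = 1\<close>, \<open>u\<close> is
  \<open>s (a u) + t (b u)\<close>. This is how primes dividing the index of a lattice are dealt
  with.\<close>

lemma int_span_bezout:
  assumes "a *s u \<in> int_span F I" "b *s u \<in> int_span F I" "coprime a b"
  shows "u \<in> int_span F I"
proof -
  obtain s t where "s * a + t * b = 1" using bezout_int[of a b] assms(3) by auto
  then have "u = s *s (a *s u) + t *s (b *s u)"
    by (metis vector_sadd_rdistrib vector_smult_assoc vector_smult_lid)
  then show ?thesis using assms(1,2) by (metis int_span_add int_span_smult)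
qed

section \<open>Linearity and coordinate sums\<close>

lemma matrix_vector_mult_smult: "A *v (c *s v) = c *s (A *v v)" for A :: "'b::comm_semiring_1 ^ 'n ^ 'm"
  by (simp add: vec_eq_iff matrix_vector_mult_def sum_distrib_left mult.left_commute)

lemma matrix_vector_mult_sum: "A *v (\<Sum>i\<in>I. f i) = (\<Sum>i\<in>I. A *v f i)" for A :: "'b::comm_ring_1 ^ 'n ^ 'm"
  by (induction I rule: infinite_finite_induct) (auto simp: matrix_vector_right_distrib)

definition total :: "int ^ 'n \<Rightarrow> int" where
  "total v = (\<Sum>i\<in>UNIV. v $ i)"

lemma total_add: "total (u + v) = total u + total v"
  and total_diff: "total (u - v) = total u - total v"
  and total_smult: "total (c *s v) = c * total v"
  and total_zero: "total 0 = 0"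
  by (simp_all add: total_def sum.distrib sum_subtractf sum_distrib_left)

lemma total_sum: "total (\<Sum>i\<in>I. f i) = (\<Sum>i\<in>I. total (f i))"
  by (induction I rule: infinite_finite_induct) (auto simp: total_add total_zero)

text \<open>Labels for the chains of \<open>T\<close> modulo \<open>p\<close>: one of length three
  through \<open>w\<close>, \<open>T w\<close> and a unit multiple of \<open>1\<close>, some of
  length two from \<open>y i\<close> to \<open>T y i\<close>, and single vectors of eigenvalue
  \<open>0\<close> (\<open>KK\<close>) and \<open>p\<close> (\<open>LL\<close>).\<close>

datatype idx = W0 | W1 | W2 | Y nat | TY nat | KK nat | LL nat

definition Idx :: "nat \<Rightarrow> nat \<Rightarrow> nat \<Rightarrow> idx set" where
  "Idx c a b = {W0, W1, W2} \<union> Y ` {..<c} \<union> TY ` {..<c} \<union> KK ` {..<a} \<union> LL ` {..<b}"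

lemma finite_Idx [simp]: "finite (Idx c a b)"
  by (simp add: Idx_def)

lemma Idx_iff [simp]:
  "W0 \<in> Idx c a b" "W1 \<in> Idx c a b" "W2 \<in> Idx c a b"
  "Y i \<in> Idx c a b \<longleftrightarrow> i < c" "TY i \<in> Idx c a b \<longleftrightarrow> i < c"
  "KK j \<in> Idx c a b \<longleftrightarrow> j < a" "LL j \<in> Idx c a b \<longleftrightarrow> j < b"
  by (auto simp: Idx_def)

lemma card_Idx: "card (Idx c a b) = 3 + 2 * c + a + b"
proof -
  have "card (KK ` {..<a} \<union> LL ` {..<b}) = a + b"
    by (subst card_Un_disjoint) (auto simp: card_image inj_on_def)
  then have "card (TY ` {..<c} \<union> (KK ` {..<a} \<union> LL ` {..<b})) = c + (a + b)"
    by (subst card_Un_disjoint) (auto simp: card_image inj_on_def)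
  then have "card (Y ` {..<c} \<union> (TY ` {..<c} \<union> (KK ` {..<a} \<union> LL ` {..<b}))) = c + (c + (a + b))"
    by (subst card_Un_disjoint) (auto simp: card_image inj_on_def)
  then have "card ({W0, W1, W2} \<union> (Y ` {..<c} \<union> (TY ` {..<c} \<union> (KK ` {..<a} \<union> LL ` {..<b}))))
      = 3 + (c + (c + (a + b)))"
    by (subst card_Un_disjoint) auto
  then show ?thesis by (simp add: Idx_def Un_assoc)
qed

primrec fam :: "int ^ 'n ^ 'n \<Rightarrow> int ^ 'n \<Rightarrow> (nat \<Rightarrow> int ^ 'n) \<Rightarrow> (nat \<Rightarrow> int ^ 'n) \<Rightarrow> (nat \<Rightarrow> int ^ 'n)
    \<Rightarrow> idx \<Rightarrow> int ^ 'n" where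
  "fam T w y k l W0 = w"
| "fam T w y k l W1 = T *v w"
| "fam T w y k l W2 = 1"
| "fam T w y k l (Y i) = y i"
| "fam T w y k l (TY i) = T *v y i"
| "fam T w y k l (KK j) = k j"
| "fam T w y k l (LL j) = l j"

text \<open>On vectors of sum zero \<open>T ^ 2 = p T\<close>, and \<open>1\<close> has eigenvalue
  \<open>r p\<close>. That \<open>p\<close> does not divide \<open>r (r - 1)\<close> makes
  \<open>T (T w)\<close> a unit multiple of \<open>1\<close> modulo \<open>p\<close> when
  \<open>total w = 1\<close>.\<close>

locale net_matrix =
  fixes p r :: int and T :: "int ^ 'n::finite ^ 'n"
  assumes prime_p: "prime p"
    and card_n: "int CARD('n) = p ^ 2"
    and not_dvd: "\<not> p dvd r * (r - 1)"
    and T_T: "\<And>v. T *v (T *v v) = p *s (T *v v) + (r * (r - 1) * total v) *s 1"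
    and T_one: "T *v 1 = (r * p) *s 1"
    and total_T: "\<And>v. total (T *v v) = r * p * total v"
begin

lemma r_ne: "r \<noteq> 0" "r \<noteq> 1" and p_ne: "p \<noteq> 0"
  using not_dvd prime_p by auto

lemma total_one: "total (1 :: int ^ 'n) = p ^ 2"
  by (simp add: total_def card_n)

lemma total_kernel: "T *v v = 0 \<Longrightarrow> total v = 0"
  using total_T[of v] r_ne p_ne by (simp add: total_zero)

lemma total_eigen: "T *v v = p *s v \<Longrightarrow> total v = 0"
  using total_T[of v] r_ne p_ne by (simp add: total_smult)

lemmas T_lin = matrix_vector_right_distrib matrix_vector_mult_diff_distrib matrix_vector_mult_smult

text \<open>\<open>p ^ 2\<close> times the projection onto the kernel of \<open>T\<close> along the other eigenspaces.\<close>

definition PK :: "int ^ 'n \<Rightarrow> int ^ 'n" where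
  "PK v = (p ^ 2) *s v - p *s (T *v v) + ((r - 1) * total v) *s 1"

lemma T_PK: "T *v PK v = 0"
  unfolding PK_def T_lin T_T T_one
  by (simp add: vec_eq_iff algebra_simps power2_eq_square)

lemma PK_add: "PK (u + v) = PK u + PK v"
  and PK_smult: "PK (c *s v) = c *s PK v"
  unfolding PK_def T_lin total_add total_smult
  by (simp_all add: vec_eq_iff algebra_simps)

lemma PK_zero: "PK 0 = 0"
  using PK_smult[of 0 0] by simp

lemma PK_sum: "PK (\<Sum>i\<in>I. f i) = (\<Sum>i\<in>I. PK (f i))"
  by (induction I rule: infinite_finite_induct) (auto simp: PK_add PK_zero)

text \<open>The equations are required of all indices, so the bounds \<open>c\<close>,
  \<open>a\<close>, \<open>b\<close> enter only through \<open>Idx\<close>; entries beyond the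
  bounds can be 0.\<close>

definition adapted :: "int ^ 'n \<Rightarrow> (nat \<Rightarrow> int ^ 'n) \<Rightarrow> (nat \<Rightarrow> int ^ 'n) \<Rightarrow> (nat \<Rightarrow> int ^ 'n) \<Rightarrow> bool" where
  "adapted w y k l \<longleftrightarrow> total w = 1 \<and> (\<forall>i. total (y i) = 0) \<and> (\<forall>j. T *v k j = 0) \<and> (\<forall>j. T *v l j = p *s l j)"

text \<open>Under the projection only the entries for \<open>w\<close>, \<open>y i\<close> and
  \<open>k j\<close> can survive, which leaves few cases when a suitable coefficient is
  sought.\<close>

lemma PK_fam:
  assumes "adapted w y k l"
  shows "PK (T *v w) = 0" "PK 1 = 0" "PK (T *v y i) = 0" "PK (k j) = (p ^ 2) *s k j" "PK (l j) = 0"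
    "PK (y i) = p *s (p *s y i - T *v y i)"
  using assms total_kernel[of "k j"] total_eigen[of "l j"]
  unfolding adapted_def PK_def T_T T_one total_T total_one
  by (simp_all add: vec_eq_iff algebra_simps power2_eq_square total_T)

text \<open>The proof expresses \<open>T\<close> on the labels with coefficients that involve only
  \<open>p\<close> and \<open>r\<close>; this is why two bases of this shape give similar
  matrices.\<close>

lemma T_fam:
  assumes "adapted w y k l" and "i \<in> Idx c a b"
  shows "T *v fam T w y k l i \<in> int_span (fam T w y k l) (Idx c a b)"
proof -
  have base: "fam T w y k l j \<in> int_span (fam T w y k l) (Idx c a b)" if "j \<in> Idx c a b" for j
    using that by (intro int_span_base) auto
  show ?thesis
  proof (cases i)
    case W0
    then show ?thesis using base[of W1] by simp
  next
    case W1
    then show ?thesis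
      using int_span_add[OF int_span_smult[OF base[of W1]] int_span_smult[OF base[of W2]]] by (simp add: T_T)
  next
    case W2
    then show ?thesis using int_span_smult[OF base[of W2]] by (simp add: T_one)
  next
    case (Y j)
    then show ?thesis using assms(2) base[of "TY j"] by simp
  next
    case (TY j)
    then show ?thesis
      using assms int_span_smult[OF base[of "TY j"]] by (simp add: T_T adapted_def)
  next
    case (KK j)
    then show ?thesis using assms(1) by (simp add: adapted_def int_span_zero)
  next
    case (LL j)
    then show ?thesis
      using assms int_span_smult[OF base[of "LL j"]] by (simp add: adapted_def)
  qed
qed

lemma T_int_span:
  assumes "adapted w y k l" and "v \<in> int_span (fam T w y k l) (Idx c a b)"
  shows "T *v v \<in> int_span (fam T w y k l) (Idx c a b)"
proof -
  obtain x where v: "v = (\<Sum>i\<in>Idx c a b. x i *s fam T w y k l i)"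
    using assms(2) unfolding int_span_def by blast
  show ?thesis
    unfolding v matrix_vector_mult_sum T_lin
    by (intro int_span_sum int_span_smult T_fam assms(1))
qed

lemma one_int_span: "1 \<in> int_span (fam T w y k l) (Idx c a b)"
  using int_span_base[of "Idx c a b" W2 "fam T w y k l"] by simp

lemma PK_int_span:
  assumes "adapted w y k l" and "v \<in> int_span (fam T w y k l) (Idx c a b)"
  shows "PK v \<in> int_span (fam T w y k l) (Idx c a b)"
  unfolding PK_def
  by (intro int_span_add int_span_diff int_span_smult T_int_span assms one_int_span)

text \<open>As \<open>x (KK j)\<close> and \<open>p ^ 2\<close> are prime to \<open>q\<close>, a
  Bezout combination \<open>z'\<close> of \<open>z\<close> and \<open>k j\<close> can replace
  \<open>k j\<close>: modulo the other entries \<open>k j\<close> is \<open>q z'\<close>, so it is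
  not lost, and \<open>z\<close> is recovered from \<open>q z\<close> and \<open>e z\<close>, with
  \<open>e\<close> prime to \<open>q\<close>. \<open>T\<close> kills \<open>z'\<close>, so the shape
  is kept.\<close>

lemma replace_kernel_vector:
  assumes ad: "adapted w y k l" and j: "j < a" and q: "prime q" "\<not> q dvd p"
    and z: "T *v z = 0" "q *s z = (\<Sum>i\<in>Idx c a b. x i *s PK (fam T w y k l i))"
    and x: "\<not> q dvd x (KK j)"
  shows "\<exists>k'. adapted w y k' l \<and> z \<in> int_span (fam T w y k' l) (Idx c a b)
    \<and> int_span (fam T w y k l) (Idx c a b) \<subseteq> int_span (fam T w y k' l) (Idx c a b)"
proof -
  have "\<not> q dvd x (KK j) * p ^ 2"
    using q x by (auto simp: prime_dvd_mult_iff prime_dvd_power_iff)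
  then have "coprime (x (KK j) * p ^ 2) q" using q(1) by (metis prime_imp_coprime coprime_commute)
  then obtain e f where ef: "e * (x (KK j) * p ^ 2) + f * q = 1"
    using bezout_int by (metis coprime_iff_gcd_eq_1)
  define z' where "z' = e *s z + f *s k j"
  define k' where "k' = k(j := z')"
  let ?F = "fam T w y k l" and ?F' = "fam T w y k' l" and ?I = "Idx c a b"
  have ad': "adapted w y k' l"
    using ad z(1) unfolding adapted_def k'_def z'_def by (auto simp: T_lin)
  have same: "?F i = ?F' i" if "i \<noteq> KK j" for i
    using that by (cases i) (auto simp: k'_def)
  have base: "?F' i \<in> int_span ?F' ?I" if "i \<in> ?I" for i
    using that by (intro int_span_base) auto
  let ?S = "\<Sum>i\<in>?I - {KK j}. x i *s PK (?F i)"
  \<comment> \<open>The entries other than \<open>KK j\<close> do not change and \<open>PK\<close>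
    preserves the new span, so the remainder \<open>?S\<close> stays available.\<close>
  have S: "?S \<in> int_span ?F' ?I"
    using same base by (intro int_span_sum int_span_smult) (auto intro: PK_int_span ad')
  have z'_in: "z' \<in> int_span ?F' ?I" using base[of "KK j"] j by (simp add: k'_def)
  have qz: "q *s z = x (KK j) *s ((p ^ 2) *s k j) + ?S"
    unfolding z(2) using j by (subst sum.remove[of _ "KK j"]) (auto simp: PK_fam[OF ad])
  have "q *s z' = e *s (q *s z) + (f * q) *s k j"
    unfolding z'_def by (simp add: vec_eq_iff algebra_simps)
  also have "\<dots> = (e * (x (KK j) * p ^ 2) + f * q) *s k j + e *s ?S"
    unfolding qz by (simp add: vec_eq_iff algebra_simps)
  finally have "k j = q *s z' - e *s ?S" unfolding ef by simp
  then have kj: "k j \<in> int_span ?F' ?I"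
    using int_span_diff[OF int_span_smult[OF z'_in] int_span_smult[OF S]] by simp
  have sub: "int_span ?F ?I \<subseteq> int_span ?F' ?I"
  proof (rule int_span_subset)
    fix i assume "i \<in> ?I"
    then show "?F i \<in> int_span ?F' ?I"
      using kj base[of i] same[of i] by (cases "i = KK j") auto
  qed
  have "q *s z \<in> int_span ?F' ?I" unfolding qz by (intro int_span_add int_span_smult kj S)
  moreover have "e *s z \<in> int_span ?F' ?I"
  proof -
    have "e *s z = z' - f *s k j" by (simp add: z'_def)
    then show ?thesis using int_span_diff[OF z'_in int_span_smult[OF kj]] by simp
  qed
  moreover have "coprime q e"
  proof (rule coprimeI)
    fix d assume "d dvd q" "d dvd e"
    then have "d dvd e * (x (KK j) * p ^ 2) + f * q" by simp
    then show "is_unit d" unfolding ef .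
  qed
  ultimately have "z \<in> int_span ?F' ?I" by (rule int_span_bezout)
  with ad' sub show ?thesis by blast
qed

text \<open>If some coefficient of a kernel vector is prime to \<open>q\<close>, the replacement
  applies directly. Otherwise \<open>k 0\<close> is first added to \<open>w\<close> or to some
  \<open>y i\<close>; as \<open>T\<close> and \<open>total\<close> vanish on \<open>k 0\<close>, the
  family stays adapted and no vector of the span is lost, while the coefficient of
  \<open>k 0\<close> becomes prime to \<open>q\<close>.\<close>

lemma enlarge_by_kernel_vector:
  assumes ad: "adapted w y k l" and a: "0 < a" and q: "prime q" "\<not> q dvd p"
    and z: "T *v z = 0" "q *s z = PK v" "v \<in> int_span (fam T w y k l) (Idx c a b)"
    and notin: "z \<notin> int_span (fam T w y k l) (Idx c a b)"
  shows "\<exists>w' y' k'. adapted w' y' k' l \<and> z \<in> int_span (fam T w' y' k' l) (Idx c a b)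
    \<and> int_span (fam T w y k l) (Idx c a b) \<subseteq> int_span (fam T w' y' k' l) (Idx c a b)"
proof -
  let ?F = "fam T w y k l" and ?I = "Idx c a b"
  obtain x where v: "v = (\<Sum>i\<in>?I. x i *s ?F i)"
    using z(3) unfolding int_span_def by blast
  have qz: "q *s z = (\<Sum>i\<in>?I. x i *s PK (?F i))"
    unfolding z(2) v PK_sum PK_smult ..
  show ?thesis
  proof (cases "\<exists>j<a. \<not> q dvd x (KK j)")
    case True
    then show ?thesis using replace_kernel_vector[OF ad _ q z(1) qz] by blast
  next
    case False
    have base: "?F i \<in> int_span ?F ?I" if "i \<in> ?I" for i
      using that by (intro int_span_base) auto
    \<comment> \<open>If \<open>q\<close> divided all coefficients that matter, division by
      \<open>q\<close> would put \<open>z\<close> into the span.\<close>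
    have "\<exists>i\<in>?I. PK (?F i) \<noteq> 0 \<and> \<not> q dvd x i"
    proof (rule ccontr)
      assume "\<not> ?thesis"
      then have "\<forall>i\<in>?I. x i *s PK (?F i) = q *s ((x i div q) *s PK (?F i))"
        by (auto simp: vec_eq_iff)
      then have "q *s z = (\<Sum>i\<in>?I. q *s ((x i div q) *s PK (?F i)))"
        unfolding qz by (intro sum.cong) auto
      then have "q *s z = q *s (\<Sum>i\<in>?I. (x i div q) *s PK (?F i))"
        by (simp add: vec_eq_iff sum_distrib_left mult.assoc)
      then have "z = (\<Sum>i\<in>?I. (x i div q) *s PK (?F i))"
        using q(1) by (auto simp: vec_eq_iff)
      then show False
        using notin int_span_sum[of ?I "\<lambda>i. (x i div q) *s PK (?F i)", OF int_span_smult[OF PK_int_span[OF ad base]]]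
        by blast
    qed
    then obtain i where i: "i \<in> ?I" "PK (?F i) \<noteq> 0" "\<not> q dvd x i" by blast
    \<comment> \<open>\<open>PK\<close> vanishes on the other labels, except for the labels
      \<open>KK j\<close>, which the case assumption excludes.\<close>
    consider "i = W0" | i' where "i = Y i'" "i' < c"
      using i False by (cases i) (auto simp: PK_fam[OF ad])
    then obtain w' y' where ad': "adapted w' y' k l"
      and shift: "\<And>n. fam T w' y' k l n = ?F n + (if n = i then k 0 else 0)" and i_ne: "i \<noteq> KK 0"
    proof cases
      case 1
      have "fam T (w + k 0) y k l n = ?F n + (if n = W0 then k 0 else 0)" for n
        using ad by (cases n) (auto simp: adapted_def T_lin)
      moreover have "adapted (w + k 0) y k l"
        using ad total_kernel[of "k 0"] by (auto simp: adapted_def total_add)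
      ultimately show ?thesis using that 1 by blast
    next
      case 2
      have "fam T w (y(i' := y i' + k 0)) k l n = ?F n + (if n = Y i' then k 0 else 0)" for n
        using ad by (cases n) (auto simp: adapted_def T_lin)
      moreover have "adapted w (y(i' := y i' + k 0)) k l"
        using ad total_kernel[of "k 0"] by (auto simp: adapted_def total_add)
      ultimately show ?thesis using that 2 by blast
    qed
    let ?F' = "fam T w' y' k l"
    have base': "?F' n \<in> int_span ?F' ?I" if "n \<in> ?I" for n
      using that by (intro int_span_base) auto
    have sub: "int_span ?F ?I \<subseteq> int_span ?F' ?I"
    proof (rule int_span_subset)
      fix n assume n: "n \<in> ?I"
      have "?F n = ?F' n - (if n = i then 1 else 0) *s ?F' (KK 0)" using shift[of n] by auto
      moreover have "?F' (KK 0) \<in> int_span ?F' ?I" using a by (intro base') simp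
      ultimately show "?F n \<in> int_span ?F' ?I"
        using int_span_diff[OF base'[OF n] int_span_smult] by simp
    qed
    \<comment> \<open>Adding \<open>k 0\<close> to entry \<open>i\<close> adds
      \<open>x i *s PK (k 0)\<close> to the sum; lowering the coefficient of \<open>k 0\<close> by
      \<open>x i\<close> compensates.\<close>
    define x' where "x' = x(KK 0 := x (KK 0) - x i)"
    have K0: "KK 0 \<in> ?I" using a by simp
    have "(\<Sum>n\<in>?I. x' n *s PK (?F' n)) = (\<Sum>n\<in>?I. x n *s PK (?F n))"
    proof -
      have "(\<Sum>n\<in>?I. x' n *s PK (?F' n)) =
        (\<Sum>n\<in>?I. x n *s PK (?F n) + (if n = i then x i *s PK (k 0) else 0)
           - (if n = KK 0 then x i *s PK (k 0) else 0))"
      proof (rule sum.cong)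
        fix n
        show "x' n *s PK (?F' n) = x n *s PK (?F n) + (if n = i then x i *s PK (k 0) else 0)
           - (if n = KK 0 then x i *s PK (k 0) else 0)"
          using i_ne by (auto simp: shift x'_def PK_add PK_zero vector_add_ldistrib vector_sub_rdistrib)
      qed simp
      also have "\<dots> = (\<Sum>n\<in>?I. x n *s PK (?F n))"
        using i(1) K0 by (simp add: sum.distrib sum_subtractf sum.delta)
      finally show ?thesis .
    qed
    then have qz': "q *s z = (\<Sum>n\<in>?I. x' n *s PK (?F' n))" using qz by simp
    have "\<not> q dvd x' (KK 0)"
      using False a i(3) dvd_add_right_iff[of q "x (KK 0)" "- x i"] by (auto simp: x'_def)
    from replace_kernel_vector[OF ad' a q z(1) qz' this]
    obtain k' where "adapted w' y' k' l" "z \<in> int_span (fam T w' y' k' l) ?I"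
      "int_span ?F' ?I \<subseteq> int_span (fam T w' y' k' l) ?I" by blast
    with sub show ?thesis by blast
  qed
qed

text \<open>Passing from \<open>T\<close> to \<open>p - T\<close> exchanges the eigenvalues \<open>0\<close> and \<open>p\<close>, hence the roles of \<open>k\<close> and \<open>l\<close>.\<close>

lemma complement_mult: "(mat p - T) *v v = p *s v - T *v v"
  by (simp add: vec_eq_iff matrix_vector_mult_def mat_def algebra_simps sum_subtractf
      if_distrib[where f = "\<lambda>c. c * _"] if_distrib[where f = "\<lambda>c. _ * c"] sum.delta sum.delta' cong: if_cong)

lemma complement_net: "net_matrix p (1 - r) (mat p - T)"
proof
  show "\<not> p dvd (1 - r) * (1 - r - 1)"
  proof -
    have "(1 - r) * (1 - r - 1) = r * (r - 1)" by (simp add: algebra_simps)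
    then show ?thesis using not_dvd by simp
  qed
  show "(mat p - T) *v ((mat p - T) *v v) =
      p *s ((mat p - T) *v v) + ((1 - r) * (1 - r - 1) * total v) *s 1" for v
    unfolding complement_mult T_lin T_T by (simp add: vec_eq_iff algebra_simps)
  show "(mat p - T) *v 1 = ((1 - r) * p) *s 1"
    unfolding complement_mult T_one by (simp add: vec_eq_iff algebra_simps)
  show "total ((mat p - T) *v v) = (1 - r) * p * total v" for v
    unfolding complement_mult total_diff total_smult total_T by (simp add: algebra_simps)
qed (use prime_p card_n in auto)

lemma complement_adapted: "net_matrix.adapted p (mat p - T) w y l k \<longleftrightarrow> adapted w y k l"
  unfolding adapted_def net_matrix.adapted_def[OF complement_net] complement_mult by auto

text \<open>\<open>T w\<close> and \<open>T y i\<close> turn into \<open>p w - T w\<close> and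
  \<open>p y i - T y i\<close>, which are integral combinations of the old entries, and the two
  kinds of eigenvectors trade places.\<close>

lemma complement_int_span_subset:
  "int_span (fam (mat p - T) w y l k) (Idx c a b) \<subseteq> int_span (fam T w y k l) (Idx c b a)"
proof (rule int_span_subset)
  fix i assume i: "i \<in> Idx c a b"
  have base: "fam T w y k l j \<in> int_span (fam T w y k l) (Idx c b a)" if "j \<in> Idx c b a" for j
    using that by (intro int_span_base) auto
  show "fam (mat p - T) w y l k i \<in> int_span (fam T w y k l) (Idx c b a)"
  proof (cases i)
    case W0
    then show ?thesis using base[of W0] by simp
  next
    case W1
    then show ?thesis
      using int_span_diff[OF int_span_smult[OF base[of W0]] base[of W1]] by (simp add: complement_mult)
  next
    case W2
    then show ?thesis using base[of W2] by simp
  next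
    case (Y j)
    then show ?thesis using i base[of "Y j"] by simp
  next
    case (TY j)
    then show ?thesis
      using i int_span_diff[OF int_span_smult[OF base[of "Y j"]] base[of "TY j"]] by (simp add: complement_mult)
  next
    case (KK j)
    then show ?thesis using i base[of "LL j"] by simp
  next
    case (LL j)
    then show ?thesis using i base[of "KK j"] by simp
  qed
qed

end

section \<open>Enlarging an adapted lattice to the lattice of all integral vectors\<close>

context net_matrix
begin

text \<open>The reverse inclusion is the same statement for \<open>p - T\<close>, because
  \<open>p - (p - T) = T\<close>.\<close>

lemma complement_int_span:
  "int_span (fam (mat p - T) w y l k) (Idx c a b) = int_span (fam T w y k l) (Idx c b a)"
proof
  show "int_span (fam T w y k l) (Idx c b a) \<subseteq> int_span (fam (mat p - T) w y l k) (Idx c a b)"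
    using net_matrix.complement_int_span_subset[OF complement_net, of w y k l c b a] by simp
qed (rule complement_int_span_subset)

text \<open>Some multiple \<open>z\<close> of \<open>v\<close> lies outside the span although
  \<open>q z\<close> lies in it for a prime \<open>q\<close> other than \<open>p\<close>. One of its
  projections to the two eigenspaces is then still outside, and the enlargement by a kernel vector
  applies to \<open>T\<close> or to \<open>p - T\<close>.\<close>

lemma enlarge:
  assumes ad: "adapted w y k l" and a: "0 < a"
    and d: "\<not> p dvd d" "d *s v \<in> int_span (fam T w y k l) (Idx c a a)" "v \<notin> int_span (fam T w y k l) (Idx c a a)"
  shows "\<exists>w' y' k' l'. adapted w' y' k' l' \<and>
    int_span (fam T w y k l) (Idx c a a) \<subset> int_span (fam T w' y' k' l') (Idx c a a)"
proof -
  let ?L = "int_span (fam T w y k l) (Idx c a a)"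
  interpret C: net_matrix p "1 - r" "mat p - T" by (rule complement_net)
  \<comment> \<open>Removing the prime factors of \<open>d\<close> one at a time, the span is left
    at some point, since \<open>v\<close> itself is outside.\<close>
  have "d *s v \<in> ?L \<Longrightarrow> d \<noteq> 0 \<Longrightarrow> \<exists>q z. prime q \<and> q dvd d \<and> q *s z \<in> ?L \<and> z \<notin> ?L"
  proof (induction d rule: prime_divisors_induct)
    case (unit x)
    have "x * x = 1" using unit(1) by (metis zdvd1_eq abs_mult_self_eq mult_1)
    then have "v = x *s (x *s v)" by (simp add: vector_smult_assoc)
    then have "v \<in> ?L" using int_span_smult[OF unit(2), of x] by simp
    with d show ?case by simp
  next
    case (factor q x)
    show ?case
    proof (cases "x *s v \<in> ?L")
      case True
      with factor show ?thesis by auto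
    next
      case False
      then have "q *s (x *s v) \<in> ?L" using factor by (simp add: vector_smult_assoc)
      with False factor show ?thesis by (meson dvd_triv_left)
    qed
  qed simp
  then obtain q z where q: "prime q" "q dvd d" and z: "q *s z \<in> ?L" "z \<notin> ?L"
    using d by (metis dvd_0_right)
  have qp: "\<not> q dvd p" using d(1) q prime_p by (metis primes_dvd_imp_eq)
  \<comment> \<open>The three spectral projections of \<open>z\<close>, each multiplied by
    \<open>p ^ 2\<close>.\<close>
  have split: "(p ^ 2) *s z = total z *s 1 + PK z + C.PK z"
    unfolding PK_def C.PK_def complement_mult by (simp add: vec_eq_iff algebra_simps power2_eq_square)
  have "PK z \<notin> ?L \<or> C.PK z \<notin> ?L"
  proof (rule ccontr)
    assume "\<not> ?thesis"
    then have "(p ^ 2) *s z \<in> ?L" unfolding split by (intro int_span_add int_span_smult one_int_span) auto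
    moreover have "coprime (p ^ 2) q"
      using q(1) qp by (metis coprime_commute coprime_power_right_iff prime_imp_coprime)
    ultimately show False using int_span_bezout[OF _ z(1)] z(2) by blast
  qed
  then show ?thesis
  proof
    assume "PK z \<notin> ?L"
    then show ?thesis
      using enlarge_by_kernel_vector[OF ad a q(1) qp T_PK _ z(1)] PK_smult[of q z] by (metis psubsetI)
  next
    assume "C.PK z \<notin> ?L"
    then obtain w' y' l' where "C.adapted w' y' l' k"
        "C.PK z \<in> int_span (fam (mat p - T) w' y' l' k) (Idx c a a)"
        "int_span (fam (mat p - T) w y l k) (Idx c a a) \<subseteq> int_span (fam (mat p - T) w' y' l' k) (Idx c a a)"
      using C.enlarge_by_kernel_vector[OF ad[folded complement_adapted] a q(1) qp C.T_PK C.PK_smult[symmetric],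
          unfolded complement_int_span, OF z(1)]
      unfolding complement_int_span by blast
    then show ?thesis
      using \<open>C.PK z \<notin> ?L\<close> unfolding complement_int_span complement_adapted by (metis psubsetI)
  qed
qed

text \<open>The span contains all multiples of \<open>d\<close>, so it is determined by its vectors
  with entries in \<open>{0..<|d|}\<close>. Each enlargement captures a new one of these finitely
  many representatives, so the process stops.\<close>

lemma exists_basis:
  assumes "adapted w y k l" and a: "0 < a" and d: "\<not> p dvd d"
    and "\<And>v. d *s v \<in> int_span (fam T w y k l) (Idx c a a)"
  shows "\<exists>w y k l. adapted w y k l \<and> int_span (fam T w y k l) (Idx c a a) = UNIV"
  using assms(1,4)
proof (induction "card ({v. \<forall>i. v $ i \<in> {0..<\<bar>d\<bar>}} - int_span (fam T w y k l) (Idx c a a))"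
    arbitrary: w y k l rule: less_induct)
  case less
  let ?B = "{v :: int ^ 'n. \<forall>i. v $ i \<in> {0..<\<bar>d\<bar>}}" and ?L = "int_span (fam T w y k l) (Idx c a a)"
  have "?B \<subseteq> vec_lambda ` (PiE UNIV (\<lambda>_. {0..<\<bar>d\<bar>}))"
    by (auto simp: image_iff intro!: bexI[of _ "vec_nth _"])
  then have fin: "finite ?B" by (rule finite_subset) (intro finite_imageI finite_PiE, auto)
  show ?case
  proof (cases "?L = UNIV")
    case True
    then show ?thesis using less(2) by blast
  next
    case False
    then obtain v where v: "v \<notin> ?L" by blast
    from enlarge[OF less(2) a d less(3) v] obtain w' y' k' l' where ad': "adapted w' y' k' l'"
      and sub: "?L \<subset> int_span (fam T w' y' k' l') (Idx c a a)" by blast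
    let ?L' = "int_span (fam T w' y' k' l') (Idx c a a)"
    obtain z where z: "z \<in> ?L'" "z \<notin> ?L" using sub by blast
    define z' where "z' = (\<chi> i. z $ i mod \<bar>d\<bar>)"
    have "d \<noteq> 0" using d by auto
    then have z'B: "z' \<in> ?B" by (auto simp: z'_def)
    \<comment> \<open>The sign makes \<open>d *s e\<close> the part removed by reduction modulo
      \<open>|d|\<close> for negative \<open>d\<close> as well.\<close>
    define e where "e = (\<chi> i. sgn d * (z $ i div \<bar>d\<bar>))"
    have zz': "z' = z - d *s e" "z = z' + d *s e"
      by (simp_all add: z'_def e_def vec_eq_iff minus_div_mult_eq_mod[symmetric] abs_sgn algebra_simps)
    have "z' \<in> ?L'" using zz'(1) z(1) less(3)[of e] sub by (metis int_span_diff psubsetD)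
    moreover have "z' \<notin> ?L" using zz'(2) z(2) less(3)[of e] by (metis int_span_add)
    ultimately have "?B - ?L' \<subset> ?B - ?L" using sub z'B by blast
    then have "card (?B - ?L') < card (?B - ?L)" using fin by (intro psubset_card_mono) auto
    then show ?thesis using less(1)[OF _ ad'] less(3) sub by blast
  qed
qed

end

section \<open>Reduction modulo the characteristic\<close>

text \<open>The target ring of \<open>red\<close> and \<open>redm\<close> is left open: a field of
  characteristic \<open>p\<close> for ranks, the rational numbers for determinants and traces, and
  finally the field that contains \<open>D\<close>.\<close>

definition red :: "int ^ 'n \<Rightarrow> 'k::ring_1 ^ 'n" where
  "red v = (\<chi> i. of_int (v $ i))"

definition redm :: "int ^ 'n ^ 'm \<Rightarrow> 'k::ring_1 ^ 'n ^ 'm" where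
  "redm A = (\<chi> i j. of_int (A $ i $ j))"

lemma red_add: "red (u + v) = red u + red v"
  and red_diff: "red (u - v) = red u - red v"
  and red_smult: "red (c *s v) = of_int c *s red v"
  and red_zero: "red 0 = 0"
  and red_one: "red 1 = 1"
  by (simp_all add: red_def vec_eq_iff)

lemma red_sum: "red (\<Sum>i\<in>I. f i) = (\<Sum>i\<in>I. red (f i))"
  by (induction I rule: infinite_finite_induct) (auto simp: red_add red_zero)

lemma red_mult: "red (A *v v) = redm A *v red v"
  by (simp add: red_def redm_def vec_eq_iff matrix_vector_mult_def)

lemma det_redm: "det (redm A :: 'k::comm_ring_1 ^ 'n ^ 'n) = of_int (det A)"
  by (simp add: det_def redm_def)

section \<open>Independent families over a field\<close>

definition independent_family :: "('i \<Rightarrow> 'k::field ^ 'n) \<Rightarrow> 'i set \<Rightarrow> bool" where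
  "independent_family f I \<longleftrightarrow> (\<forall>x. (\<Sum>i\<in>I. x i *s f i) = 0 \<longrightarrow> (\<forall>i\<in>I. x i = 0))"

lemma independent_familyD:
  "independent_family f I \<Longrightarrow> (\<Sum>i\<in>I. x i *s f i) = 0 \<Longrightarrow> i \<in> I \<Longrightarrow> x i = 0"
  unfolding independent_family_def by blast

lemma independent_family_bij:
  assumes "vec.independent B" "bij_betw f I B" "finite I"
  shows "independent_family f I"
  unfolding independent_family_def
proof (intro allI impI ballI)
  fix x i assume s: "(\<Sum>i\<in>I. x i *s f i) = 0" and i: "i \<in> I"
  let ?g = "the_inv_into I f"
  have inj: "inj_on f I" and B: "B = f ` I" using assms(2) by (auto simp: bij_betw_def)
  have "(\<Sum>v\<in>B. x (?g v) *s v) = (\<Sum>i\<in>I. x (?g (f i)) *s f i)"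
    unfolding B by (subst sum.reindex[OF inj]) simp
  also have "\<dots> = 0" using s by (simp add: the_inv_into_f_f[OF inj])
  finally have "x (?g (f i)) = 0"
    using assms(1,3) i B by (intro vec.independentD[of B B "\<lambda>v. x (?g v)" "f i"]) auto
  then show "x i = 0" using i by (simp add: the_inv_into_f_f[OF inj])
qed

lemma independent_family_inj:
  assumes "independent_family f I" "finite I"
  shows "inj_on f I"
proof (rule inj_onI, rule ccontr)
  fix i j assume ij: "i \<in> I" "j \<in> I" "f i = f j" "i \<noteq> j"
  have "(\<Sum>n\<in>I. ((if n = i then 1 else 0) - (if n = j then 1 else 0)) *s f n) = 0"
    using ij assms(2)
    by (simp add: vector_sub_rdistrib sum_subtractf if_distrib[where f = "\<lambda>c. c *s _"] sum.delta cong: if_cong)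
  from independent_familyD[OF assms(1) this ij(1)] ij(4) show False by simp
qed

lemma independent_family_image:
  assumes "independent_family f I" "finite I"
  shows "vec.independent (f ` I)"
proof (rule vec.independent_if_scalars_zero)
  show "finite (f ` I)" using assms(2) by simp
  fix x v assume s: "(\<Sum>v\<in>f ` I. x v *s v) = 0" and v: "v \<in> f ` I"
  from s have "(\<Sum>i\<in>I. x (f i) *s f i) = 0"
    using independent_family_inj[OF assms] by (simp add: sum.reindex)
  then show "x v = 0" using v independent_familyD[OF assms(1), of "\<lambda>i. x (f i)"] by blast
qed

lemma span_family:
  assumes "finite I" "v \<in> vec.span (f ` I)" "inj_on f I"
  obtains x where "v = (\<Sum>i\<in>I. x i *s f i)"
proof -
  from assms obtain u where "v = (\<Sum>w\<in>f ` I. u w *s w)" by (auto simp: vec.span_finite)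
  then have "v = (\<Sum>i\<in>I. u (f i) *s f i)" using assms(3) by (simp add: sum.reindex)
  then show ?thesis by (rule that)
qed

section \<open>Frobenius and the prime field\<close>

lemma of_int_power_CHAR:
  assumes "prime CHAR('k::comm_ring_1)"
  shows "(of_int z :: 'k) ^ CHAR('k) = of_int z"
proof -
  let ?P = "CHAR('k)"
  have n: "(of_nat n :: 'k) ^ ?P = of_nat n" for n
    using assms by (induction n) (auto simp: freshmans_dream power_0_left)
  have P: "?P > 0" using assms by (simp add: prime_gt_0_nat)
  have "of_int z = (of_nat (nat (z mod int ?P)) :: 'k)"
  proof -
    have "(of_int z :: 'k) = of_int (z mod int ?P) + of_int (int ?P) * of_int (z div int ?P)"
      by (metis add.commute mult_div_mod_eq of_int_add of_int_mult)
    also have "\<dots> = of_int (z mod int ?P)" by simp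
    also have "\<dots> = of_int (int (nat (z mod int ?P)))" using P by simp
    finally show ?thesis by (simp only: of_int_of_nat_eq)
  qed
  then show ?thesis by (simp only: n)
qed

text \<open>With \<open>P = CHAR('k)\<close>, the polynomial \<open>x ^ P - x\<close> has at most
  \<open>P\<close> roots, and the \<open>P\<close> distinct multiples of 1 are roots
  already.\<close>

lemma prime_subfield:
  assumes "prime CHAR('k::field)" "x ^ CHAR('k) = (x :: 'k)"
  shows "\<exists>z. x = of_int z"
proof -
  let ?P = "CHAR('k)"
  have P1: "?P > 1" by (rule prime_gt_1_nat[OF assms(1)])
  let ?f = "Polynomial.monom (1::'k) ?P - Polynomial.monom 1 1"
  have dg: "degree ?f \<le> ?P"
    using P1 by (intro degree_diff_le) (auto simp: degree_monom_eq)
  have "poly.coeff ?f ?P = 1" using P1 by simp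
  then have nz: "?f \<noteq> 0" by (metis coeff_0 zero_neq_one)
  have roots: "{x. poly ?f x = 0} = {x. x ^ ?P = x}" by (auto simp: poly_monom)
  have "inj_on (of_nat :: nat \<Rightarrow> 'k) {..<?P}"
  proof (rule inj_onI)
    fix m n assume mn: "m \<in> {..<?P}" "n \<in> {..<?P}" "(of_nat m :: 'k) = of_nat n"
    then have "(of_int (int m - int n) :: 'k) = 0" by simp
    then have d: "int ?P dvd int m - int n" by (simp only: of_int_eq_0_iff_char_dvd)
    show "m = n"
    proof (rule ccontr)
      assume "m \<noteq> n"
      then have "int ?P \<le> \<bar>int m - int n\<bar>" using dvd_imp_le_int[OF _ d] by simp
      then show False using mn(1,2) by (auto simp: abs_if split: if_splits)
    qed
  qed
  then have card: "card ((of_nat :: nat \<Rightarrow> 'k) ` {..<?P}) = ?P" by (simp add: card_image)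
  have sub: "of_nat ` {..<?P} \<subseteq> {x::'k. x ^ ?P = x}"
  proof
    fix y :: 'k assume "y \<in> of_nat ` {..<?P}"
    then obtain n where "y = of_int (int n)" by auto
    then show "y \<in> {x. x ^ ?P = x}" using of_int_power_CHAR[OF assms(1), of "int n"] by simp
  qed
  have fin: "finite {x::'k. x ^ ?P = x}" using poly_roots_finite[OF nz] by (simp only: roots)
  have "card {x::'k. x ^ ?P = x} \<le> ?P" using card_poly_roots_bound[OF nz] dg by (simp only: roots)
  then have "of_nat ` {..<?P} = {x::'k. x ^ ?P = x}" using card_seteq[OF fin sub] card by simp
  then have "x \<in> of_nat ` {..<?P}" using assms(2) by simp
  then obtain n where "x = of_int (int n)" by auto
  then show ?thesis by blast
qed

text \<open>Frobenius fixes integral vectors, so by uniqueness it fixes their coefficients.\<close>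

lemma integral_coefficients:
  fixes v :: "'i \<Rightarrow> int ^ 'n" and x :: "'i \<Rightarrow> 'k::field"
  assumes P: "prime CHAR('k)" and I: "finite I"
    and ind: "independent_family (\<lambda>i. red (v i) :: 'k ^ 'n) I"
    and u: "red u = (\<Sum>i\<in>I. x i *s (red (v i) :: 'k ^ 'n))"
  shows "\<exists>z. \<forall>i\<in>I. x i = of_int (z i)"
proof -
  let ?P = "CHAR('k)"
  have "(\<Sum>i\<in>I. x i ^ ?P *s (red (v i) :: 'k ^ 'n)) = red u"
  proof (unfold vec_eq_iff, rule allI)
    fix j
    have "(\<Sum>i\<in>I. x i ^ ?P *s (red (v i) :: 'k ^ 'n)) $ j = (\<Sum>i\<in>I. (x i * of_int (v i $ j)) ^ ?P)"
      by (simp add: red_def power_mult_distrib of_int_power_CHAR[OF P])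
    also have "\<dots> = (\<Sum>i\<in>I. x i * of_int (v i $ j)) ^ ?P"
      by (simp add: freshmans_dream_sum[OF P refl])
    also have "(\<Sum>i\<in>I. x i * of_int (v i $ j)) = of_int (u $ j)"
      using arg_cong[OF u, of "\<lambda>w. w $ j"] by (simp add: red_def)
    finally show "(\<Sum>i\<in>I. x i ^ ?P *s (red (v i) :: 'k ^ 'n)) $ j = red u $ j"
      by (simp add: of_int_power_CHAR[OF P] red_def)
  qed
  then have "(\<Sum>i\<in>I. (x i ^ ?P - x i) *s (red (v i) :: 'k ^ 'n)) = 0"
    unfolding u by (simp add: vector_sub_rdistrib sum_subtractf)
  then have "x i ^ ?P = x i" if "i \<in> I" for i using independent_familyD[OF ind _ that] by fastforce
  then have "\<forall>i\<in>I. \<exists>z. x i = of_int z" using prime_subfield[OF P] by blast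
  then show ?thesis by (rule bchoice)
qed

section \<open>Integral vectors killed by T modulo p\<close>

context net_matrix
begin

lemma prime_CHAR: "int CHAR('k::ring_1) = p \<Longrightarrow> prime CHAR('k)"
  using prime_p by (metis prime_int_nat_transfer nat_int prime_nat_int_transfer)

lemma of_int_eq_0:
  assumes "int CHAR('k::ring_1) = p"
  shows "(of_int z :: 'k) = 0 \<longleftrightarrow> p dvd z"
  using of_int_eq_0_iff_char_dvd[of z, where ?'a = 'k] assms by simp

lemma red_eq_0:
  assumes "int CHAR('k::ring_1) = p" and "(red v :: 'k ^ 'n) = 0"
  obtains u where "v = p *s u"
proof -
  have "\<forall>i. p dvd v $ i" using assms(2) of_int_eq_0[OF assms(1)] by (simp add: red_def vec_eq_iff)
  then have "v = p *s (\<chi> i. v $ i div p)" by (simp add: vec_eq_iff)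
  then show ?thesis using that by blast
qed

text \<open>Write \<open>T u = p g\<close>. The quadratic equation for \<open>T\<close> shows that
  \<open>p\<close> divides \<open>total u\<close>. Once a multiple of \<open>p w\<close> is
  subtracted to make the sum zero, \<open>g'\<close> is an eigenvector for \<open>p\<close>, and
  \<open>u' - g'\<close> lies in the kernel of \<open>T\<close>.\<close>

lemma kernel_mod_p:
  assumes ch: "int CHAR('k::ring_1) = p" and u: "(red (T *v u) :: 'k ^ 'n) = 0" and w: "total (w :: int ^ 'n) = 1"
  obtains k l where "T *v k = 0" "T *v l = p *s l" "(red u :: 'k ^ 'n) = red k + red l"
proof -
  obtain g where g: "T *v u = p *s g" using red_eq_0[OF ch u] by blast
  have "p *s (T *v g) = p *s (p *s g) + (r * (r - 1) * total u) *s 1"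
    using T_T[of u] unfolding g T_lin .
  then have "p * (T *v g) $ i = p * (p * g $ i) + r * (r - 1) * total u" for i
    by (simp add: vec_eq_iff)
  then have "r * (r - 1) * total u = p * ((T *v g) $ i - p * g $ i)" for i
    by (metis add_diff_cancel_left' right_diff_distrib)
  then have "p dvd r * (r - 1) * total u" by (metis dvd_triv_left)
  then have "p dvd total u" using not_dvd prime_p prime_dvd_mult_iff by blast
  then obtain s where s: "total u = p * s" by blast
  define u' where "u' = u - (p * s) *s w"
  define g' where "g' = g - s *s (T *v w)"
  have Tu': "T *v u' = p *s g'"
    unfolding u'_def g'_def T_lin g by (simp add: vec_eq_iff algebra_simps)
  have tot: "total u' = 0" by (simp add: u'_def total_diff total_smult w s)
  have "p *s (T *v g') = p *s (p *s g')"
    using T_T[of u'] unfolding tot Tu' T_lin by simp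
  then have Tg': "T *v g' = p *s g'" using p_ne by (auto simp: vec_eq_iff)
  have "(of_int p :: 'k) = 0" using of_int_eq_0[OF ch] by simp
  then have "(red u :: 'k ^ 'n) = red (u' - g') + red g'"
    by (simp add: u'_def red_diff red_smult)
  then show ?thesis using that[of "u' - g'" g'] by (simp add: T_lin Tu' Tg')
qed

end

section \<open>An adapted basis modulo p\<close>

context net_matrix
begin

text \<open>Rank-nullity made explicit. The image of \<open>T\<close> modulo \<open>p\<close> has a
  basis formed by the images of \<open>w\<close>, \<open>T w\<close> and \<open>c\<close> vectors
  \<open>y i\<close> of sum zero. In the kernel, \<open>1\<close> and the \<open>T y i\<close> are
  completed by reductions of integral vectors of eigenvalue \<open>0\<close> and \<open>p\<close>.
  Nothing is said yet about how \<open>a\<close> and \<open>b\<close> compare.\<close>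

lemma exists_basis_mod_p:
  assumes ch: "int CHAR('k::field) = p"
    and dim: "vec.dim (range (\<lambda>v :: 'k ^ 'n. redm T *v v)) = c + 2"
  shows "\<exists>a b w y k l. adapted w y k l \<and> independent_family (\<lambda>i. red (fam T w y k l i) :: 'k ^ 'n) (Idx c a b)
    \<and> vec.span ((\<lambda>i. red (fam T w y k l i) :: 'k ^ 'n) ` Idx c a b) = UNIV"
proof -
  note eq0 = of_int_eq_0[OF ch]
  define w :: "int ^ 'n" where "w = axis undefined 1"
  have w: "total w = 1" by (simp add: w_def total_def axis_def)
  define m :: 'k where "m = of_int (r * (r - 1))"
  have m: "m \<noteq> 0" using not_dvd eq0 by (simp only: m_def) simp
  have p0: "(of_int p :: 'k) = 0" using eq0 by simp
  define tv :: "int ^ 'n \<Rightarrow> 'k ^ 'n" where "tv v = red (T *v v)" for v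
  have tv: "tv (u + v) = tv u + tv v" "tv (u - v) = tv u - tv v" "tv (z *s u) = of_int z *s tv u" for u v z
    by (simp_all add: tv_def T_lin red_add red_diff red_smult)
  have tvTw: "tv (T *v w) = m *s 1"
    by (simp add: tv_def T_T w red_add red_smult red_one p0 m_def)
  have tv1: "tv 1 = 0"
    by (simp add: tv_def T_one red_smult p0)
  have tvT: "tv (T *v v) = 0" if "total v = 0" for v
    using that by (simp add: tv_def T_T red_smult red_add p0 red_zero)
  have one_ne: "(1 :: 'k ^ 'n) \<noteq> 0" by (simp add: vec_eq_iff)
  define im where "im = range (\<lambda>v :: 'k ^ 'n. redm T *v v)"
  have sub_im: "vec.subspace im" unfolding im_def
    by (metis vec.subspace_UNIV vec.subspace_image)
  have tv_im: "tv v \<in> im" for v unfolding tv_def im_def red_mult by blast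
  define SY where "SY = {tv y |y. total y = 0}"
  have ind0: "vec.independent {tv w, tv (T *v w)}"
  proof -
    have "tv w \<notin> vec.span {tv (T *v w)}"
    proof
      assume "tv w \<in> vec.span {tv (T *v w)}"
      then obtain e where "tv w = e *s (m *s 1)" by (auto simp: vec.span_singleton tvTw)
      then have "redm T *v tv w = (e * m) *s (redm T *v red 1)"
        by (simp add: matrix_vector_mult_smult red_one vector_smult_assoc)
      then have "tv (T *v w) = (e * m) *s tv 1" by (simp add: tv_def red_mult)
      then show False using m one_ne by (simp add: tv1 tvTw)
    qed
    moreover have "tv (T *v w) \<noteq> 0" using m one_ne by (simp add: tvTw)
    ultimately show ?thesis by (simp add: vec.independent_insert)
  qed
  \<comment> \<open>Extending inside \<open>SY\<close> ensures that the further basis vectors come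
    from integral vectors of sum zero.\<close>
  obtain B where B: "{tv w, tv (T *v w)} \<subseteq> B" "B \<subseteq> {tv w, tv (T *v w)} \<union> SY"
    "vec.independent B" "{tv w, tv (T *v w)} \<union> SY \<subseteq> vec.span B"
    using vec.maximal_independent_subset_extend[OF _ ind0, of "{tv w, tv (T *v w)} \<union> SY"] by blast
  have finB: "finite B" using B(3) by (rule vec.finiteI_independent)
  have tv_span: "tv v \<in> vec.span B" for v
  proof -
    have "tv v = of_int (total v) *s tv w + tv (v - total v *s w)" by (simp add: tv)
    moreover have "tv (v - total v *s w) \<in> SY"
      unfolding SY_def using w by (auto intro!: exI[of _ "v - total v *s w"] simp: total_diff total_smult)
    ultimately show ?thesis using B(1,4) by (metis (no_types, lifting) Un_iff insertI1 subsetD vec.span_add vec.span_scale)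
  qed
  have "im = vec.span B"
  proof
    have "B \<subseteq> im" using B(2) tv_im by (auto simp: SY_def)
    then show "vec.span B \<subseteq> im" using sub_im by (rule vec.span_minimal)
    show "im \<subseteq> vec.span B"
    proof
      fix v assume "v \<in> im"
      then obtain x :: "'k ^ 'n" where v: "v = redm T *v x" by (auto simp: im_def)
      have "v = redm T *v (\<Sum>i\<in>UNIV. (x $ i) *s axis i 1)" unfolding v by (simp add: basis_expansion)
      also have "\<dots> = (\<Sum>i\<in>UNIV. (x $ i) *s tv (axis i 1))"
        unfolding matrix_vector_mult_sum matrix_vector_mult_smult tv_def red_mult
        by (simp add: red_def axis_def if_distrib[where f = of_int] cong: if_cong)
      also have "\<dots> \<in> vec.span B" by (intro vec.span_sum vec.span_scale tv_span)
      finally show "v \<in> vec.span B" .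
    qed
  qed
  then have cB: "card B = c + 2"
    using dim B(3) by (simp add: im_def[symmetric] vec.dim_eq_card_independent)
  define B' where "B' = B - {tv w, tv (T *v w)}"
  have ne: "tv w \<noteq> tv (T *v w)"
  proof
    assume eq: "tv w = tv (T *v w)"
    have "redm T *v tv w = redm T *v (m *s red 1)" by (simp add: eq tvTw red_one)
    then have "tv (T *v w) = m *s tv 1" by (simp add: tv_def red_mult matrix_vector_mult_smult)
    then show False using m one_ne by (simp add: tv1 tvTw)
  qed
  have "card B' = c" unfolding B'_def using B(1) cB ne finB by (subst card_Diff_subset) auto
  then obtain f where f: "bij_betw f {..<c} B'"
    using finB by (metis B'_def finite_Diff ex_bij_betw_nat_finite atLeast0LessThan)
  have "\<exists>y. total y = 0 \<and> (i < c \<longrightarrow> tv y = f i)" for i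
  proof (cases "i < c")
    case True
    then have "f i \<in> SY" using f B(2) by (auto simp: bij_betw_def B'_def)
    then show ?thesis by (auto simp: SY_def)
  next
    case False
    then show ?thesis using total_zero by blast
  qed
  then obtain y where y: "\<And>i. total (y i) = 0" "\<And>i. i < c \<Longrightarrow> tv (y i) = f i" by metis
  define h where "h i = fam T w y (\<lambda>_. 0) (\<lambda>_. 0) i" for i
  let ?I1 = "{W0, W1} \<union> Y ` {..<c}" and ?I2 = "{W2} \<union> TY ` {..<c}"
  have "bij_betw (\<lambda>i. tv (h i)) ?I1 ({tv w, tv (T *v w)} \<union> B')"
  proof (rule bij_betw_combine)
    show "bij_betw (\<lambda>i. tv (h i)) {W0, W1} {tv w, tv (T *v w)}"
      using ne by (auto simp: bij_betw_def h_def)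
    have "bij_betw ((\<lambda>i. tv (h i)) \<circ> Y) {..<c} B'"
      using f by (rule bij_betw_cong[THEN iffD1, rotated]) (simp add: h_def y)
    then show "bij_betw (\<lambda>i. tv (h i)) (Y ` {..<c}) B'"
      by (simp add: bij_betw_def inj_on_image_iff comp_inj_on_iff image_comp inj_on_def)
  qed (auto simp: B'_def)
  moreover have "{tv w, tv (T *v w)} \<union> B' = B" using B(1) by (auto simp: B'_def)
  ultimately have bij1: "bij_betw (\<lambda>i. tv (h i)) ?I1 B" by simp
  have ind1: "independent_family (\<lambda>i. tv (h i)) ?I1"
    using B(3) bij1 by (rule independent_family_bij) simp
  have ind2: "independent_family (\<lambda>i. red (h i) :: 'k ^ 'n) ?I2"
    unfolding independent_family_def
  proof (rule allI, rule impI)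
    fix x assume s: "(\<Sum>i\<in>?I2. x i *s (red (h i) :: 'k ^ 'n)) = 0"
    \<comment> \<open>Since \<open>tv (T *v w) = m *s 1\<close>, a coefficient of \<open>1\<close>
      becomes one of \<open>tv (T *v w)\<close> after division by \<open>m\<close>; that of
      \<open>T y j\<close> becomes one of \<open>tv (y j)\<close>.\<close>
    define x' where "x' i = (case i of W1 \<Rightarrow> x W2 / m | Y j \<Rightarrow> x (TY j) | _ \<Rightarrow> 0)" for i
    have "(\<Sum>i\<in>?I1. x' i *s tv (h i)) = (\<Sum>i\<in>?I2. x i *s (red (h i) :: 'k ^ 'n))"
      by (simp add: x'_def h_def tvTw m red_one sum.reindex inj_on_def image_iff tv_def[of "y _"])
    then have "(\<Sum>i\<in>?I1. x' i *s tv (h i)) = 0" using s by simp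
    then have x': "x' i = 0" if "i \<in> ?I1" for i using independent_familyD[OF ind1 _ that] by blast
    have "x W2 = 0" using x'[of W1] m by (simp add: x'_def)
    moreover have "x (TY i) = 0" if "i < c" for i using x'[of "Y i"] that by (simp add: x'_def)
    ultimately show "\<forall>i\<in>?I2. x i = 0" by auto
  qed
  define SK :: "('k ^ 'n) set" where "SK = red ` {v. T *v v = 0}"
  define SL :: "('k ^ 'n) set" where "SL = red ` {v. T *v v = p *s v}"
  let ?B2 = "(\<lambda>i. red (h i) :: 'k ^ 'n) ` ?I2"
  have "vec.independent ?B2" using ind2 by (rule independent_family_image) simp
  then obtain D where D: "?B2 \<subseteq> D" "D \<subseteq> ?B2 \<union> (SK \<union> SL)" "vec.independent D" "?B2 \<union> (SK \<union> SL) \<subseteq> vec.span D"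
    by (rule vec.maximal_independent_subset_extend[OF Un_upper1])
  have finD: "finite D" using D(3) by (rule vec.finiteI_independent)
  \<comment> \<open>A vector in both \<open>SK\<close> and \<open>SL\<close> is counted among the
    kernel vectors only.\<close>
  define DK where "DK = (D - ?B2) \<inter> SK"
  define DL where "DL = (D - ?B2) - SK"
  obtain a fk where fk: "bij_betw fk {..<a::nat} DK"
    using finD by (metis DK_def finite_Diff finite_Int ex_bij_betw_nat_finite atLeast0LessThan)
  obtain b fl where fl: "bij_betw fl {..<b::nat} DL"
    using finD by (metis DL_def finite_Diff finite_Int ex_bij_betw_nat_finite atLeast0LessThan)
  have "\<exists>v. T *v v = 0 \<and> (i < a \<longrightarrow> red v = fk i)" for i
  proof (cases "i < a")
    case True
    then have "fk i \<in> SK" using fk by (auto simp: bij_betw_def DK_def)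
    then show ?thesis by (auto simp: SK_def)
  next
    case False
    then show ?thesis using matrix_vector_mult_0_right by blast
  qed
  then obtain k where k: "\<And>i. T *v k i = 0" "\<And>i. i < a \<Longrightarrow> red (k i) = fk i" by metis
  have "\<exists>v. T *v v = p *s v \<and> (i < b \<longrightarrow> red v = fl i)" for i
  proof (cases "i < b")
    case True
    then have "fl i \<in> SL" using fl D(2) by (auto simp: bij_betw_def DL_def)
    then show ?thesis by (auto simp: SL_def)
  next
    case False
    then show ?thesis by (intro exI[of _ 0]) simp
  qed
  then obtain l where l: "\<And>i. T *v l i = p *s l i" "\<And>i. i < b \<Longrightarrow> red (l i) = fl i" by metis
  let ?F = "fam T w y k l"
  let ?R = "\<lambda>i. red (?F i) :: 'k ^ 'n"
  let ?I3 = "?I2 \<union> (KK ` {..<a} \<union> LL ` {..<b})"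
  have ad: "adapted w y k l" unfolding adapted_def using w y k l by auto
  have bij3: "bij_betw ?R ?I3 (?B2 \<union> (DK \<union> DL))"
  proof (intro bij_betw_combine)
    have "inj_on (\<lambda>i. red (h i) :: 'k ^ 'n) ?I2" using independent_family_inj[OF ind2] by simp
    then have "bij_betw (\<lambda>i. red (h i) :: 'k ^ 'n) ?I2 ?B2" by (simp add: bij_betw_def)
    then show "bij_betw ?R ?I2 ?B2"
      by (rule bij_betw_cong[THEN iffD1, rotated]) (auto simp: h_def)
    have "bij_betw (?R \<circ> KK) {..<a} DK"
      using fk by (rule bij_betw_cong[THEN iffD1, rotated]) (simp add: k)
    then show "bij_betw ?R (KK ` {..<a}) DK"
      by (simp add: bij_betw_def inj_on_image_iff comp_inj_on_iff image_comp inj_on_def)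
    have "bij_betw (?R \<circ> LL) {..<b} DL"
      using fl by (rule bij_betw_cong[THEN iffD1, rotated]) (simp add: l)
    then show "bij_betw ?R (LL ` {..<b}) DL"
      by (simp add: bij_betw_def inj_on_image_iff comp_inj_on_iff image_comp inj_on_def)
  qed (auto simp: DK_def DL_def)
  moreover have D_eq: "?B2 \<union> (DK \<union> DL) = D" using D(1) by (auto simp: DK_def DL_def)
  ultimately have ind3: "independent_family ?R ?I3"
    using D(3) by (intro independent_family_bij[of D]) auto
  have I: "Idx c a b = ?I1 \<union> ?I3" by (auto simp: Idx_def)
  have disj: "?I1 \<inter> ?I3 = {}" by auto
  have fin: "finite ?I1" "finite ?I3" by auto
  have tv3: "tv (?F i) = 0" if "i \<in> ?I3" for i
    using that tvT y(1) by (auto simp: tv1 tv_def[of "k _"] tv_def[of "l _"] k l red_smult p0 red_zero)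
  have tv1h: "tv (?F i) = tv (h i)" if "i \<in> ?I1" for i
    using that by (auto simp: h_def)
  have indep: "independent_family ?R (Idx c a b)"
    unfolding independent_family_def
  proof (rule allI, rule impI)
    fix x assume s: "(\<Sum>i\<in>Idx c a b. x i *s ?R i) = 0"
    \<comment> \<open>Applying \<open>T\<close> kills the part indexed by \<open>?I3\<close> and
      isolates the coefficients over \<open>?I1\<close>.\<close>
    have "0 = redm T *v (\<Sum>i\<in>Idx c a b. x i *s ?R i)" by (simp add: s)
    also have "\<dots> = (\<Sum>i\<in>Idx c a b. x i *s tv (?F i))"
      by (simp add: matrix_vector_mult_sum matrix_vector_mult_smult tv_def red_mult)
    also have "\<dots> = (\<Sum>i\<in>?I1. x i *s tv (?F i)) + (\<Sum>i\<in>?I3. x i *s tv (?F i))"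
      unfolding I by (rule sum.union_disjoint[OF fin disj])
    also have "(\<Sum>i\<in>?I3. x i *s tv (?F i)) = 0" using tv3 by (intro sum.neutral) simp
    also have "(\<Sum>i\<in>?I1. x i *s tv (?F i)) = (\<Sum>i\<in>?I1. x i *s tv (h i))"
      using tv1h by (intro sum.cong) auto
    finally have "(\<Sum>i\<in>?I1. x i *s tv (h i)) = 0" by simp
    then have x1: "x i = 0" if "i \<in> ?I1" for i using independent_familyD[OF ind1 _ that] by blast
    have "(\<Sum>i\<in>Idx c a b. x i *s ?R i) = (\<Sum>i\<in>?I1. x i *s ?R i) + (\<Sum>i\<in>?I3. x i *s ?R i)"
      unfolding I by (rule sum.union_disjoint[OF fin disj])
    also have "(\<Sum>i\<in>?I1. x i *s ?R i) = 0" using x1 by (intro sum.neutral) simp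
    finally have "(\<Sum>i\<in>?I3. x i *s ?R i) = 0" using s by simp
    then have "x i = 0" if "i \<in> ?I3" for i using independent_familyD[OF ind3 _ that] by blast
    with x1 show "\<forall>i\<in>Idx c a b. x i = 0" unfolding I by blast
  qed
  have red_span: "red v \<in> vec.span (?R ` Idx c a b)" for v
  proof -
    have "tv v \<in> vec.span ((\<lambda>i. tv (h i)) ` ?I1)" using tv_span[of v] bij1 by (simp add: bij_betw_def)
    then obtain x where x: "tv v = (\<Sum>i\<in>?I1. x i *s tv (h i))"
      by (rule span_family[rotated]) (use bij1 in \<open>auto simp: bij_betw_def\<close>)
    \<comment> \<open>Integral coefficients make \<open>u\<close> below an integral vector, to which
      \<open>kernel_mod_p\<close> applies.\<close>
    have "\<exists>z. \<forall>i\<in>?I1. x i = of_int (z i)"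
      using integral_coefficients[OF prime_CHAR[OF ch] fin(1), of "\<lambda>i. T *v h i" "T *v v" x] ind1 x
      unfolding tv_def by blast
    then obtain z where z: "\<And>i. i \<in> ?I1 \<Longrightarrow> x i = of_int (z i)" by blast
    define u where "u = v - (\<Sum>i\<in>?I1. z i *s ?F i)"
    have "tv (\<Sum>i\<in>?I1. z i *s ?F i) = (\<Sum>i\<in>?I1. of_int (z i) *s tv (?F i))"
      by (simp add: tv_def matrix_vector_mult_sum matrix_vector_mult_smult red_sum red_smult)
    also have "\<dots> = tv v" unfolding x using z tv1h by (intro sum.cong) auto
    finally have "red (T *v u) = (0 :: 'k ^ 'n)" unfolding u_def tv_def[symmetric] tv by simp
    from kernel_mod_p[OF ch this w] obtain k' l' where kl: "T *v k' = 0" "T *v l' = p *s l'"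
      "(red u :: 'k ^ 'n) = red k' + red l'" .
    have "D = ?R ` ?I3" using bij3 D_eq by (simp add: bij_betw_def)
    then have sub: "vec.span D \<subseteq> vec.span (?R ` Idx c a b)" unfolding I by (intro vec.span_mono) auto
    have "red k' \<in> vec.span D" "red l' \<in> vec.span D"
      using D(4) kl by (auto simp: SK_def SL_def)
    then have "red u \<in> vec.span (?R ` Idx c a b)" unfolding kl(3) using sub by (meson subsetD vec.span_add)
    moreover have "red v = red u + (\<Sum>i\<in>?I1. of_int (z i) *s ?R i)"
      by (simp add: u_def red_diff red_sum red_smult)
    moreover have "(\<Sum>i\<in>?I1. of_int (z i) *s ?R i) \<in> vec.span (?R ` Idx c a b)"
      unfolding I by (intro vec.span_sum vec.span_scale vec.span_base) auto
    ultimately show ?thesis by (simp add: vec.span_add)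
  qed
  have "v \<in> vec.span (?R ` Idx c a b)" for v :: "'k ^ 'n"
  proof -
    have "v = (\<Sum>i\<in>UNIV. (v $ i) *s red (axis i 1))"
      by (subst basis_expansion[of v, symmetric], intro sum.cong refl arg_cong[where f = "\<lambda>u. _ *s u"])
         (simp add: red_def axis_def vec_eq_iff)
    also have "\<dots> \<in> vec.span (?R ` Idx c a b)" by (intro vec.span_sum vec.span_scale red_span)
    finally show ?thesis .
  qed
  then show ?thesis using ad indep by blast
qed

end

section \<open>Normal bases\<close>

definition colmat :: "('n \<Rightarrow> 'b ^ 'm) \<Rightarrow> 'b ^ 'n ^ 'm" where
  "colmat g = (\<chi> i j. g j $ i)"

lemma colmat_mult: "colmat g *v x = (\<Sum>j\<in>UNIV. x $ j *s g j)" for g :: "'n::finite \<Rightarrow> 'b::comm_ring_1 ^ 'm"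
  by (simp add: vec_eq_iff matrix_vector_mult_def colmat_def mult.commute)

lemma colmat_axis: "colmat g *v axis j 1 = g j" for g :: "'n::finite \<Rightarrow> 'b::comm_ring_1 ^ 'm"
  by (simp add: colmat_mult axis_def if_distrib[where f = "\<lambda>c. c *s _"] sum.delta cong: if_cong)

lemma mult_axis_component: "(A *v axis j 1) $ i = A $ i $ j" for A :: "'b::comm_ring_1 ^ 'n ^ 'm"
  by (simp add: matrix_vector_mult_def axis_def if_distrib[where f = "\<lambda>c. _ * c"] cong: if_cong)

lemma redm_mult: "redm (A ** B) = redm A ** redm B"
  by (simp add: redm_def matrix_matrix_mult_def vec_eq_iff)

lemma redm_mat: "redm (mat z) = mat (of_int z)"
  by (simp add: redm_def mat_def vec_eq_iff)

lemma redm_inject: "redm A = (redm B :: 'k::ring_char_0 ^ 'n ^ 'm) \<longleftrightarrow> A = B"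
  by (simp add: redm_def vec_eq_iff)

lemma int_matrix_left_inverse:
  fixes A B :: "int ^ 'n ^ 'n"
  assumes "A ** B = mat 1" shows "B ** A = mat 1"
proof -
  have "redm A ** redm B = (mat 1 :: rat ^ 'n ^ 'n)"
    by (simp add: redm_mult[symmetric] assms redm_mat)
  then have "redm B ** redm A = (mat 1 :: rat ^ 'n ^ 'n)" by (simp add: matrix_left_right_inverse)
  then have "redm (B ** A) = (redm (mat 1) :: rat ^ 'n ^ 'n)" by (simp add: redm_mult redm_mat)
  then show ?thesis by (simp only: redm_inject)
qed

text \<open>Cramer's rule over the rationals: the numerators are determinants of integral matrices,
  so clearing the single denominator leaves integers.\<close>

lemma det_smult_colmat:
  fixes g :: "'n::finite \<Rightarrow> int ^ 'n"
  assumes "det (colmat g) \<noteq> 0"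
  shows "\<exists>z. det (colmat g) *s v = (\<Sum>j\<in>UNIV. z j *s g j)"
proof -
  let ?P = "colmat g"
  let ?PQ = "redm ?P :: rat ^ 'n ^ 'n"
  have d: "det ?PQ = of_int (det ?P)" by (rule det_redm)
  then have d0: "det ?PQ \<noteq> 0" using assms by simp
  define z where "z k = det (\<chi> i j. if j = k then v $ i else ?P $ i $ j)" for k
  define x :: "rat ^ 'n" where "x = (\<chi> k. det (\<chi> i j. if j = k then red v $ i else ?PQ $ i $ j) / det ?PQ)"
  have "det (\<chi> i j. if j = k then red v $ i else ?PQ $ i $ j) = (of_int (z k) :: rat)" for k
    unfolding z_def det_redm[symmetric]
    by (rule arg_cong[where f = det]) (simp add: vec_eq_iff redm_def red_def)
  then have x: "x $ k = of_int (z k) / of_int (det ?P)" for k by (simp add: x_def d)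
  have "?PQ *v x = red v" using cramer[OF d0, of x "red v"] by (simp add: x_def)
  then have "(\<Sum>j\<in>UNIV. of_int (?P $ i $ j) * x $ j) = of_int (v $ i)" for i
    by (simp add: matrix_vector_mult_def redm_def red_def vec_eq_iff)
  then have "of_int (det ?P) * (\<Sum>j\<in>UNIV. of_int (?P $ i $ j) * x $ j) = (of_int (det ?P * v $ i) :: rat)" for i
    by simp
  then have "(of_int (\<Sum>j\<in>UNIV. ?P $ i $ j * z j) :: rat) = of_int (det ?P * v $ i)" for i
    using assms by (simp add: x sum_distrib_left mult.left_commute)
  then have "(\<Sum>j\<in>UNIV. ?P $ i $ j * z j) = det ?P * v $ i" for i by (simp only: of_int_eq_iff)
  then have "det ?P *s v = (\<Sum>j\<in>UNIV. z j *s g j)"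
    by (simp add: vec_eq_iff colmat_def mult.commute)
  then show ?thesis by blast
qed

lemma sum_Idx:
  "(\<Sum>i\<in>Idx c a b. f i) = f W0 + f W1 + f W2 + (\<Sum>i<c. f (Y i)) + (\<Sum>i<c. f (TY i))
    + (\<Sum>j<a. f (KK j)) + (\<Sum>j<b. f (LL j))" for f :: "idx \<Rightarrow> 'b::comm_monoid_add"
proof -
  have "Idx c a b = {W0, W1, W2} \<union> (Y ` {..<c} \<union> (TY ` {..<c} \<union> (KK ` {..<a} \<union> LL ` {..<b})))"
    by (auto simp: Idx_def)
  also have "(\<Sum>i\<in>\<dots>. f i) = (\<Sum>i\<in>{W0, W1, W2}. f i) + ((\<Sum>i\<in>Y ` {..<c}. f i)
     + ((\<Sum>i\<in>TY ` {..<c}. f i) + ((\<Sum>i\<in>KK ` {..<a}. f i) + (\<Sum>i\<in>LL ` {..<b}. f i))))"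
    by (subst sum.union_disjoint, simp, simp, force)+ simp
  finally show ?thesis by (simp add: sum.reindex inj_on_def add.assoc)
qed

lemma bij_to_Idx:
  assumes "CARD('n::finite) = 3 + 2 * c + a + b"
  obtains h :: "'n::finite \<Rightarrow> idx" where "bij_betw h UNIV (Idx c a b)"
  using finite_same_card_bij[of "UNIV :: 'n set" "Idx c a b"] assms by (auto simp: card_Idx)

section \<open>From bases modulo p to integral bases\<close>

context net_matrix
begin

text \<open>In the rational basis given by the family, the diagonal entries of \<open>T\<close> are
  \<open>p\<close> at \<open>T w\<close>, \<open>T y i\<close> and \<open>l j\<close>,
  \<open>r p\<close> at \<open>1\<close>, and \<open>0\<close> elsewhere. A known trace therefore
  determines \<open>b\<close>.\<close>

lemma trace_adapted:
  assumes ad: "adapted w y k l" and h: "bij_betw h UNIV (Idx c a b)"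
    and d: "det (colmat (\<lambda>j. fam T w y k l (h j))) \<noteq> 0"
  shows "trace T = p * (1 + r + int c + int b)"
proof -
  let ?F = "fam T w y k l"
  let ?P = "colmat (\<lambda>j. ?F (h j))"
  let ?PQ = "redm ?P :: rat ^ 'n ^ 'n"
  have "det ?PQ \<noteq> 0" using d by (simp add: det_redm)
  then obtain B where B: "?PQ ** B = mat 1" "B ** ?PQ = mat 1"
    using invertible_det_nz[of ?PQ] by (auto simp: invertible_def)
  \<comment> \<open>The coordinate of \<open>v\<close> at the basis vector with label
    \<open>h j\<close>.\<close>
  define \<phi> where "\<phi> j v = (B *v red v) $ j" for j v
  have red_F: "red (?F (h i)) = ?PQ *v axis i 1" for i
  proof -
    have "red (?F (h i)) = (red (?P *v axis i 1) :: rat ^ 'n)" by (simp only: colmat_axis)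
    also have "\<dots> = ?PQ *v red (axis i 1)" by (rule red_mult)
    also have "red (axis i 1) = (axis i 1 :: rat ^ 'n)" by (simp add: red_def axis_def vec_eq_iff)
    finally show ?thesis .
  qed
  have \<phi>_F: "\<phi> j (?F (h i)) = (if i = j then 1 else 0)" for i j
  proof -
    have "B *v red (?F (h i)) = axis i 1" by (simp add: red_F matrix_vector_mul_assoc B)
    then show ?thesis by (simp add: \<phi>_def axis_def)
  qed
  have \<phi>_add: "\<phi> j (u + v) = \<phi> j u + \<phi> j v" for j u v
    by (simp add: \<phi>_def red_add matrix_vector_right_distrib)
  have \<phi>_smult: "\<phi> j (z *s v) = of_int z * \<phi> j v" for j v z
    by (simp add: \<phi>_def red_smult matrix_vector_mult_smult)
  have inj: "h i = h j \<longleftrightarrow> i = j" for i j using h by (auto simp: bij_betw_def inj_on_eq_iff)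
  have \<phi>': "\<phi> j (?F i) = (if h j = i then 1 else 0)" if "i \<in> Idx c a b" for i j
  proof -
    have "i \<in> range h" using h that by (simp add: bij_betw_def)
    then obtain i' where "i = h i'" by blast
    then show ?thesis using \<phi>_F[of j i'] by (auto simp: inj)
  qed
  define \<theta> where "\<theta> i = (case i of W1 \<Rightarrow> p | W2 \<Rightarrow> r * p | TY _ \<Rightarrow> p | LL _ \<Rightarrow> p | _ \<Rightarrow> 0)" for i
  have hI: "h j \<in> Idx c a b" for j using h by (auto simp: bij_betw_def)
  have diag: "\<phi> j (T *v ?F (h j)) = of_int (\<theta> (h j))" for j
  proof (cases "h j")
    case W0
    then show ?thesis using \<phi>'[of W1 j] by (simp add: \<theta>_def)
  next
    case W1
    then show ?thesis using \<phi>'[of W1 j] \<phi>'[of W2 j] by (simp add: \<theta>_def T_T \<phi>_add \<phi>_smult)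
  next
    case W2
    then show ?thesis using \<phi>'[of W2 j] by (simp add: \<theta>_def T_one \<phi>_smult)
  next
    case (Y i)
    then show ?thesis using \<phi>'[of "TY i" j] hI[of j] by (simp add: \<theta>_def)
  next
    case (TY i)
    then show ?thesis using \<phi>'[of "TY i" j] hI[of j] ad by (simp add: \<theta>_def T_T \<phi>_smult adapted_def)
  next
    case (KK i)
    then show ?thesis using ad \<phi>_smult[of j 0 0] by (simp add: \<theta>_def adapted_def)
  next
    case (LL i)
    then show ?thesis using \<phi>'[of "LL i" j] hI[of j] ad by (simp add: \<theta>_def \<phi>_smult adapted_def)
  qed
  have "of_int (trace T) = (trace (redm T) :: rat)" by (simp add: trace_def redm_def)
  also have "\<dots> = trace ((redm T ** ?PQ) ** B)" by (simp add: matrix_mul_assoc[symmetric] B)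
  also have "\<dots> = trace (B ** (redm T ** ?PQ))" by (rule trace_mul_sym)
  also have "\<dots> = (\<Sum>j\<in>UNIV. of_int (\<theta> (h j)))"
    unfolding trace_def
  proof (rule sum.cong)
    fix j
    have "(B ** (redm T ** ?PQ)) $ j $ j = ((B ** (redm T ** ?PQ)) *v axis j 1) $ j"
      by (simp only: mult_axis_component)
    also have "\<dots> = \<phi> j (T *v ?F (h j))"
      by (simp add: \<phi>_def matrix_vector_mul_assoc[symmetric] red_mult red_F)
    finally show "(B ** (redm T ** ?PQ)) $ j $ j = of_int (\<theta> (h j))" using diag by simp
  qed simp
  also have "\<dots> = of_int (\<Sum>i\<in>Idx c a b. \<theta> i)"
    using sum.reindex_bij_betw[OF h, of \<theta>] by (simp flip: of_int_sum)
  also have "(\<Sum>i\<in>Idx c a b. \<theta> i) = p * (1 + r + int c + int b)"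
    by (simp add: sum_Idx \<theta>_def algebra_simps)
  finally show ?thesis by (simp only: of_int_eq_iff)
qed

text \<open>Here \<open>s\<close> is the multiplicity of the eigenvalue \<open>p\<close> on vectors
  of sum zero. The trace gives \<open>b = s - 1 - c\<close>, then \<open>2 * s = p ^ 2 - 1\<close>
  forces \<open>a = b\<close>, and the bound on \<open>c\<close> makes this number positive. The
  determinant of the lifted basis is prime to \<open>p\<close>, so it can play the role of
  \<open>d\<close> in \<open>exists_basis\<close>.\<close>

theorem exists_normal_basis:
  assumes ch: "int CHAR('k::field) = p"
    and dim: "vec.dim (range (\<lambda>v :: 'k ^ 'n. redm T *v v)) = c + 2"
    and tr: "trace T = p * (r + s)" and s: "2 * s = p ^ 2 - 1" and c: "int c < s - 1"
  shows "\<exists>a w y k l. CARD('n) = 3 + 2 * c + a + a \<and> adapted w y k l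
    \<and> int_span (fam T w y k l) (Idx c a a) = UNIV"
proof -
  obtain a b w y k l where ad: "adapted w y k l"
    and ind: "independent_family (\<lambda>i. red (fam T w y k l i) :: 'k ^ 'n) (Idx c a b)"
    and span: "vec.span ((\<lambda>i. red (fam T w y k l i) :: 'k ^ 'n) ` Idx c a b) = UNIV"
    using exists_basis_mod_p[OF ch dim] by blast
  let ?F = "fam T w y k l"
  let ?R = "\<lambda>i. red (?F i) :: 'k ^ 'n"
  have "card (?R ` Idx c a b) = CARD('n)"
    using vec.dim_span_eq_card_independent[OF independent_family_image[OF ind]] span
    by (simp add: card_cart_basis)
  then have card: "CARD('n) = 3 + 2 * c + a + b"
    using independent_family_inj[OF ind] by (simp add: card_image card_Idx)
  then obtain h :: "'n \<Rightarrow> idx" where h: "bij_betw h UNIV (Idx c a b)" by (rule bij_to_Idx)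
  let ?P = "colmat (\<lambda>j. ?F (h j))"
  have "\<exists>B. B ** redm ?P = (mat 1 :: 'k ^ 'n ^ 'n)"
    unfolding matrix_left_invertible_independent_columns
  proof (intro allI impI)
    fix x i assume "(\<Sum>j\<in>UNIV. x j *s column j (redm ?P :: 'k ^ 'n ^ 'n)) = 0"
    moreover have "column j (redm ?P :: 'k ^ 'n ^ 'n) = ?R (h j)" for j
      by (simp add: column_def redm_def red_def colmat_def)
    ultimately have "(\<Sum>j\<in>UNIV. x j *s ?R (h j)) = 0" by simp
    then have "(\<Sum>j\<in>UNIV. x (inv_into UNIV h (h j)) *s ?R (h j)) = 0"
      using h by (simp add: bij_betw_def)
    then have "(\<Sum>i\<in>Idx c a b. x (inv_into UNIV h i) *s ?R i) = 0"
      using sum.reindex_bij_betw[OF h, of "\<lambda>i. x (inv_into UNIV h i) *s ?R i"] by simp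
    moreover have "h i \<in> Idx c a b" using h by (auto simp: bij_betw_def)
    ultimately have "x (inv_into UNIV h (h i)) = 0"
      by (rule independent_familyD[OF ind, of "\<lambda>i. x (inv_into UNIV h i)"])
    then show "x i = 0" using h by (simp add: bij_betw_def)
  qed
  then have "det (redm ?P :: 'k ^ 'n ^ 'n) \<noteq> 0"
    using invertible_det_nz invertible_left_inverse by blast
  then have pd: "\<not> p dvd det ?P" by (simp add: det_redm of_int_eq_0[OF ch])
  then have d0: "det ?P \<noteq> 0" by auto
  have "p * (r + s) = p * (1 + r + int c + int b)" using trace_adapted[OF ad h d0] tr by simp
  then have "s = 1 + int c + int b" using p_ne by simp
  moreover have "int CARD('n) = 2 * s + 1" using card_n s by simp
  ultimately have ab: "b = a" "0 < a" using card c by auto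
  have "det ?P *s v \<in> int_span ?F (Idx c a a)" for v
  proof -
    obtain z where "det ?P *s v = (\<Sum>j\<in>UNIV. z j *s ?F (h j))" using det_smult_colmat[OF d0] by blast
    moreover have "?F (h j) \<in> int_span ?F (Idx c a a)" for j
      using h ab by (intro int_span_base) (auto simp: bij_betw_def)
    ultimately show ?thesis by (simp add: int_span_sum int_span_smult)
  qed
  from exists_basis[OF ad ab(2) pd this] show ?thesis using card ab by auto
qed

lemma int_span_UNIV_inverse:
  fixes h :: "'n \<Rightarrow> idx"
  assumes h: "bij_betw h UNIV (Idx c a b)" and "int_span (fam T w y k l) (Idx c a b) = UNIV"
  obtains Q where "colmat (\<lambda>j. fam T w y k l (h j)) ** Q = mat 1"
    "Q ** colmat (\<lambda>j. fam T w y k l (h j)) = mat 1"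
proof -
  let ?F = "fam T w y k l"
  have "\<exists>z :: int ^ 'n. colmat (\<lambda>j. ?F (h j)) *v z = v" for v
  proof -
    have "v \<in> int_span ?F (Idx c a b)" using assms(2) by simp
    then obtain x where "v = (\<Sum>i\<in>Idx c a b. x i *s ?F i)" by (auto simp: int_span_def)
    also have "\<dots> = (\<Sum>j\<in>UNIV. x (h j) *s ?F (h j))"
      using sum.reindex_bij_betw[OF h, of "\<lambda>i. x i *s ?F i"] by simp
    also have "\<dots> = colmat (\<lambda>j. ?F (h j)) *v (\<chi> j. x (h j))" by (simp add: colmat_mult)
    finally show ?thesis by blast
  qed
  then obtain q where q: "\<And>v. colmat (\<lambda>j. ?F (h j)) *v q v = (v :: int ^ 'n)" by metis
  have "colmat (\<lambda>j. ?F (h j)) ** colmat (\<lambda>j. q (axis j 1)) = mat 1"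
  proof -
    have "(colmat (\<lambda>j. ?F (h j)) ** colmat (\<lambda>j. q (axis j 1))) $ i $ j = mat 1 $ i $ j" for i j
    proof -
      have "(colmat (\<lambda>j. ?F (h j)) ** colmat (\<lambda>j. q (axis j 1))) $ i $ j
          = (colmat (\<lambda>j. ?F (h j)) *v q (axis j 1)) $ i"
        by (simp add: matrix_matrix_mult_def matrix_vector_mult_def colmat_def)
      also have "\<dots> = mat 1 $ i $ j" by (simp add: q axis_def mat_def)
      finally show ?thesis .
    qed
    then show ?thesis by (simp add: vec_eq_iff)
  qed
  then show ?thesis using that int_matrix_left_inverse by blast
qed

end

text \<open>\<open>C\<close> carries one basis to the other label by label, and both matrices act on
  the labels by the same formulas in \<open>p\<close> and \<open>r\<close>. Fixing \<open>1\<close>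
  and preserving \<open>total\<close> lets the similarity pass to combinations with the identity and
  the all-one matrix.\<close>

theorem similar_if_normal_bases:
  fixes S T :: "int ^ 'n ^ 'n"
  assumes S: "net_matrix p r S" and T: "net_matrix p r T"
    and card: "CARD('n) = 3 + 2 * c + a + a"
    and bS: "net_matrix.adapted p S w y k l" "int_span (fam S w y k l) (Idx c a a) = UNIV"
    and bT: "net_matrix.adapted p T w' y' k' l'" "int_span (fam T w' y' k' l') (Idx c a a) = UNIV"
  shows "\<exists>C C'. C ** C' = mat 1 \<and> C' ** C = mat 1 \<and> C ** S = T ** C \<and> C *v 1 = 1
    \<and> (\<forall>v. total (C *v v) = total v)"
proof -
  interpret S: net_matrix p r S by (rule S)
  interpret T: net_matrix p r T by (rule T)
  obtain h :: "'n \<Rightarrow> idx" where h: "bij_betw h UNIV (Idx c a a)" using card by (rule bij_to_Idx)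
  let ?F = "fam S w y k l" and ?G = "fam T w' y' k' l'"
  let ?P = "colmat (\<lambda>j. ?F (h j))" and ?R = "colmat (\<lambda>j. ?G (h j))"
  obtain Q where Q: "?P ** Q = mat 1" "Q ** ?P = mat 1" using S.int_span_UNIV_inverse[OF h bS(2)] .
  obtain Q' where Q': "?R ** Q' = mat 1" "Q' ** ?R = mat 1" using T.int_span_UNIV_inverse[OF h bT(2)] .
  define C where "C = ?R ** Q"
  define C' where "C' = ?P ** Q'"
  have "C ** C' = ?R ** (Q ** ?P) ** Q'" by (simp add: C_def C'_def matrix_mul_assoc)
  then have inv: "C ** C' = mat 1" by (simp add: Q Q')
  have C_F: "C *v ?F i = ?G i" if "i \<in> Idx c a a" for i
  proof -
    have "i \<in> range h" using h that by (simp add: bij_betw_def)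
    then obtain j where j: "i = h j" by blast
    have "C *v ?F i = C *v (?P *v axis j 1)" by (simp add: colmat_axis j)
    also have "\<dots> = ?R *v ((Q ** ?P) *v axis j 1)"
      by (simp add: C_def matrix_vector_mul_assoc matrix_mul_assoc)
    also have "\<dots> = ?G i" by (simp add: Q colmat_axis j)
    finally show ?thesis .
  qed
  have C_base: "C *v (S *v ?F i) = T *v (C *v ?F i)" if i: "i \<in> Idx c a a" for i
  proof (cases i)
    case W0
    then show ?thesis using C_F[of W0] C_F[of W1] by simp
  next
    case W1
    then show ?thesis using C_F[of W1] C_F[of W2] bS(1) bT(1)
      by (simp add: S.T_T T.T_T S.T_lin S.adapted_def T.adapted_def)
  next
    case W2
    then show ?thesis using C_F[of W2] by (simp add: S.T_one T.T_one S.T_lin)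
  next
    case (Y j)
    then show ?thesis using i C_F[of "Y j"] C_F[of "TY j"] by simp
  next
    case (TY j)
    then show ?thesis using i C_F[of "TY j"] bS(1) bT(1)
      by (simp add: S.T_T T.T_T S.T_lin S.adapted_def T.adapted_def)
  next
    case (KK j)
    then show ?thesis using i C_F[of "KK j"] bS(1) bT(1) by (simp add: S.adapted_def T.adapted_def)
  next
    case (LL j)
    then show ?thesis using i C_F[of "LL j"] bS(1) bT(1)
      by (simp add: S.T_lin S.adapted_def T.adapted_def)
  qed
  have comm: "C *v (S *v v) = T *v (C *v v)" for v
  proof -
    have "v \<in> int_span ?F (Idx c a a)" using bS(2) by simp
    then obtain x where v: "v = (\<Sum>i\<in>Idx c a a. x i *s ?F i)" by (auto simp: int_span_def)
    show ?thesis unfolding v matrix_vector_mult_sum matrix_vector_mult_smult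
      using C_base by (intro sum.cong) auto
  qed
  then have "(C ** S) *v v = (T ** C) *v v" for v by (simp add: matrix_vector_mul_assoc)
  then have "C ** S = T ** C" by (simp add: matrix_eq)
  moreover have one: "C *v 1 = 1" using C_F[of W2] by simp
  moreover have "total (C *v v) = total v" for v
  proof -
    \<comment> \<open>Comparing the quadratic equations of \<open>S\<close> and \<open>T\<close>
      through \<open>C\<close> cancels everything but the multiples of \<open>1\<close>.\<close>
    have "C *v (S *v (S *v v)) = T *v (T *v (C *v v))" by (simp add: comm)
    then have "(r * (r - 1) * total v) *s (1 :: int ^ 'n) = (r * (r - 1) * total (C *v v)) *s 1"
      unfolding S.T_T T.T_T S.T_lin comm one by simp
    then show ?thesis using S.r_ne by (simp add: vec_eq_iff)
  qed
  ultimately show ?thesis using inv int_matrix_left_inverse[OF inv] by blast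
qed

section \<open>The rank of a net modulo p\<close>

lemma independent_family_comp:
  assumes f: "independent_family f J" and \<phi>: "inj_on \<phi> I" "\<phi> ` I \<subseteq> J" and J: "finite J"
  shows "independent_family (\<lambda>i. f (\<phi> i)) I"
  unfolding independent_family_def
proof (intro allI impI ballI)
  fix x i assume s: "(\<Sum>i\<in>I. x i *s f (\<phi> i)) = 0" and i: "i \<in> I"
  define y where "y j = (if j \<in> \<phi> ` I then x (the_inv_into I \<phi> j) else 0)" for j
  have "(\<Sum>j\<in>J. y j *s f j) = (\<Sum>j\<in>\<phi> ` I. y j *s f j)"
    using \<phi>(2) J by (intro sum.mono_neutral_right) (auto simp: y_def)
  also have "\<dots> = (\<Sum>i\<in>I. x i *s f (\<phi> i))"
    using \<phi>(1) by (simp add: sum.reindex y_def the_inv_into_f_f)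
  finally have "y (\<phi> i) = 0" using s i \<phi>(2) independent_familyD[OF f, of y "\<phi> i"] by auto
  then show "x i = 0" using i \<phi>(1) by (simp add: y_def the_inv_into_f_f)
qed

text \<open>Complete \<open>B\<close> to a basis and invert the matrix with these rows; the column
  belonging to \<open>B i0\<close> is the required vector.\<close>

lemma exists_dual_vector:
  fixes B :: "'i \<Rightarrow> 'k::field ^ 'n"
  assumes B: "independent_family B I" "finite I" and i0: "i0 \<in> I"
  obtains f where "\<And>i. i \<in> I \<Longrightarrow> (\<Sum>v\<in>UNIV. B i $ v * f $ v) = (if i = i0 then 1 else 0)"
proof -
  obtain G where G: "B ` I \<subseteq> G" "vec.independent G" "UNIV \<subseteq> vec.span G"
    using vec.maximal_independent_subset_extend[OF subset_UNIV independent_family_image[OF B]] by metis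
  have "vec.span G = UNIV" using G(3) by auto
  then have "card G = CARD('n)"
    using vec.dim_span_eq_card_independent[OF G(2)] by (simp only: vec_dim_card)
  then obtain g :: "'n \<Rightarrow> 'k ^ 'n" where g: "bij_betw g UNIV G"
    using vec.finiteI_independent[OF G(2)] finite_same_card_bij[of "UNIV :: 'n set" G] by auto
  define R :: "'k ^ 'n ^ 'n" where "R = (\<chi> j. g j)"
  have "independent_family g UNIV" using G(2) g by (rule independent_family_bij) simp
  then have "\<exists>R'. R ** R' = mat 1"
    unfolding matrix_right_invertible_independent_rows independent_family_def by (simp add: R_def row_def)
  then obtain R' where R': "R ** R' = mat 1" by blast
  have Bg: "\<exists>j. g j = B i" if "i \<in> I" for i
  proof -
    have "B i \<in> range g" using G(1) g that by (auto simp: bij_betw_def)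
    then show ?thesis by (metis rangeE)
  qed
  obtain j0 where j0: "g j0 = B i0" using Bg[OF i0] by blast
  show ?thesis
  proof (rule that[of "\<chi> v. R' $ v $ j0"])
    fix i assume i: "i \<in> I"
    then obtain j where j: "g j = B i" using Bg by blast
    have "j = j0 \<longleftrightarrow> i = i0"
      using j j0 i i0 g independent_family_inj[OF B] by (auto simp: bij_betw_def inj_on_def) 
    moreover have "(R ** R') $ j $ j0 = (\<Sum>v\<in>UNIV. B i $ v * R' $ v $ j0)"
      by (simp add: matrix_matrix_mult_def R_def j)
    ultimately show "(\<Sum>v\<in>UNIV. B i $ v * (\<chi> v. R' $ v $ j0) $ v) = (if i = i0 then 1 else 0)"
      by (simp add: R' mat_def)
  qed
qed

text \<open>Vectors dual to the \<open>B i\<close> show that every \<open>A i\<close> is attained,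
  so the image is exactly the span of the \<open>A i\<close>.\<close>

lemma dim_range_tensor_sum:
  fixes A :: "'i \<Rightarrow> 'k::field ^ 'm" and B :: "'i \<Rightarrow> 'k ^ 'n"
  assumes A: "independent_family A I" and B: "independent_family B I" and I: "finite I"
    and M: "\<And>x y. M $ x $ y = (\<Sum>i\<in>I. A i $ x * B i $ y)"
  shows "vec.dim (range ((*v) M)) = card I"
proof -
  have Mf: "M *v f = (\<Sum>i\<in>I. (\<Sum>v\<in>UNIV. B i $ v * f $ v) *s A i)" for f
  proof -
    have "(M *v f) $ x = (\<Sum>i\<in>I. (\<Sum>v\<in>UNIV. B i $ v * f $ v) *s A i) $ x" for x
    proof -
      have "(M *v f) $ x = (\<Sum>v\<in>UNIV. \<Sum>i\<in>I. A i $ x * B i $ v * f $ v)"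
        by (simp add: matrix_vector_mult_def M sum_distrib_right)
      also have "\<dots> = (\<Sum>i\<in>I. \<Sum>v\<in>UNIV. A i $ x * B i $ v * f $ v)" by (rule sum.swap)
      also have "\<dots> = (\<Sum>i\<in>I. (\<Sum>v\<in>UNIV. B i $ v * f $ v) *s A i) $ x"
        by (simp add: sum_distrib_left sum_distrib_right mult_ac)
      finally show ?thesis .
    qed
    then show ?thesis by (simp add: vec_eq_iff)
  qed
  have "range ((*v) M) = vec.span (A ` I)"
  proof
    show "range ((*v) M) \<subseteq> vec.span (A ` I)"
    proof
      fix u assume "u \<in> range ((*v) M)"
      then obtain f where "u = (\<Sum>i\<in>I. (\<Sum>v\<in>UNIV. B i $ v * f $ v) *s A i)" using Mf by auto
      then show "u \<in> vec.span (A ` I)"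
        by (simp only:) (intro vec.span_sum vec.span_scale vec.span_base imageI)
    qed
    have "A i \<in> range ((*v) M)" if i: "i \<in> I" for i
    proof -
      obtain f where f: "\<And>j. j \<in> I \<Longrightarrow> (\<Sum>v\<in>UNIV. B j $ v * f $ v) = (if j = i then 1 else 0)"
        using exists_dual_vector[OF B I i] by blast
      have "M *v f = (\<Sum>j\<in>I. (if j = i then 1 else 0) *s A j)"
        unfolding Mf using f by (intro sum.cong) auto
      also have "\<dots> = A i"
        using i I by (simp add: if_distrib[where f = "\<lambda>c. c *s _"] sum.delta cong: if_cong)
      finally show ?thesis by (metis rangeI)
    qed
    moreover have "vec.subspace (range ((*v) M))"
      by (metis vec.subspace_UNIV vec.subspace_image)
    ultimately show "vec.span (A ` I) \<subseteq> range ((*v) M)" by (intro vec.span_minimal) auto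
  qed
  then show ?thesis
    using vec.dim_span_eq_card_independent[OF independent_family_image[OF A I]]
      independent_family_inj[OF A I] by (simp add: card_image)
qed

section \<open>Polynomials and Hankel matrices\<close>

lemma polynomial_sum_eq_0:
  fixes x :: "nat \<Rightarrow> 'k::field"
  assumes "finite S" "n \<le> card S" "\<And>t. t \<in> S \<Longrightarrow> (\<Sum>a<n. x a * t ^ a) = 0" "a < n"
  shows "x a = 0"
proof -
  define f where "f = Poly (map x [0..<n])"
  have co: "poly.coeff f i = (if i < n then x i else 0)" for i
    by (simp add: f_def nth_default_def)
  have "poly f t = (\<Sum>a<n. x a * t ^ a)" for t
  proof -
    have "degree f \<le> n - 1" using co by (intro degree_le) auto
    then have "{..degree f} \<subseteq> {..<n}" using assms(4) by auto
    then have "(\<Sum>i\<le>degree f. poly.coeff f i * t ^ i) = (\<Sum>i<n. poly.coeff f i * t ^ i)"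
      by (intro sum.mono_neutral_left) (auto simp: coeff_eq_0)
    then show ?thesis using co by (simp add: poly_altdef)
  qed
  then have sub: "S \<subseteq> {t. poly f t = 0}" using assms(3) by auto
  have "f = 0"
  proof (rule ccontr)
    assume f: "f \<noteq> 0"
    have "card S \<le> card {t. poly f t = 0}" using sub poly_roots_finite[OF f] by (rule card_mono[rotated])
    also have "\<dots> \<le> degree f" using f by (rule card_poly_roots_bound)
    also have "degree f < n"
    proof -
      have "poly.coeff f (degree f) \<noteq> 0" using f by simp
      then show ?thesis using co by (auto split: if_splits)
    qed
    finally show False using assms(2) by simp
  qed
  then show ?thesis using co[of a] assms(4) by simp
qed

text \<open>The values \<open>t * X t\<close> on \<open>S\<close> are orthogonal to all polynomials
  of degree below \<open>card S\<close>. Testing against the product \<open>R\<close> that vanishes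
  on \<open>S - {t0}\<close> gives \<open>X t0 = 0\<close>, as \<open>t0\<close> is nonzero; then
  \<open>X\<close> has too many zeros for its degree.\<close>

lemma hankel_injective:
  fixes S :: "'k::field set"
  assumes S: "finite S" "0 \<notin> S" and n: "n \<le> card S"
    and h: "\<And>b. b < card S \<Longrightarrow> (\<Sum>a<n. x a * (\<Sum>t\<in>S. t ^ (a + b + 1))) = 0"
    and a: "a < n"
  shows "x a = 0"
proof -
  define X where "X t = (\<Sum>a<n. x a * t ^ a)" for t
  have b: "(\<Sum>t\<in>S. t * X t * t ^ b) = 0" if "b < card S" for b
  proof -
    have "(\<Sum>t\<in>S. t * X t * t ^ b) = (\<Sum>t\<in>S. \<Sum>a<n. x a * t ^ (a + b + 1))"
      by (simp add: X_def sum_distrib_left sum_distrib_right power_add mult_ac)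
    also have "\<dots> = (\<Sum>a<n. x a * (\<Sum>t\<in>S. t ^ (a + b + 1)))"
      by (subst sum.swap) (simp add: sum_distrib_left)
    finally show ?thesis using h[OF that] by simp
  qed
  have "X t0 = 0" if t0: "t0 \<in> S" for t0
  proof -
    define R where "R = (\<Prod>u\<in>S - {t0}. [:- u, 1:])"
    have "degree R = card S - 1"
      unfolding R_def using S(1) t0 by (subst degree_prod_eq_sum_degree) auto
    then have dR: "degree R < card S" using S(1) t0 by (metis card_gt_0_iff diff_less empty_iff less_one)
    have "(\<Sum>t\<in>S. t * X t * poly R t) = (\<Sum>t\<in>S. \<Sum>b\<le>degree R. poly.coeff R b * (t * X t * t ^ b))"
      by (simp add: poly_altdef sum_distrib_left mult_ac)
    also have "\<dots> = (\<Sum>b\<le>degree R. poly.coeff R b * (\<Sum>t\<in>S. t * X t * t ^ b))"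
      by (subst sum.swap) (simp add: sum_distrib_left)
    also have "\<dots> = 0" using b dR by (intro sum.neutral) auto
    finally have "(\<Sum>t\<in>S. t * X t * poly R t) = 0" .
    moreover have "(\<Sum>t\<in>S. t * X t * poly R t) = t0 * X t0 * poly R t0"
    proof -
      have "poly R t = 0" if "t \<in> S - {t0}" for t
        unfolding R_def poly_prod using S(1) that by (intro prod_zero) auto
      then show ?thesis by (subst sum.remove[OF S(1) t0]) auto
    qed
    moreover have "poly R t0 \<noteq> 0" using S(1) by (auto simp: R_def poly_prod)
    moreover have "t0 \<noteq> 0" using S(2) t0 by auto
    ultimately show ?thesis by simp
  qed
  then show ?thesis using polynomial_sum_eq_0[OF S(1) n _ a, of x] by (auto simp: X_def)
qed

text \<open>The terms are 1, 2, ..., n, n + 1, n, ..., 2, 1. The induction removes both ends and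
  lowers every other term by one.\<close>

lemma sum_min_eq_square: "(\<Sum>k<2 * n + 1. Suc (min k (2 * n - k))) = (n + 1) ^ 2"
proof (induction n)
  case (Suc n)
  have "(\<Sum>k<2 * Suc n + 1. Suc (min k (2 * Suc n - k)))
      = (\<Sum>k<2 * n + 1. Suc (min (Suc k) (2 * Suc n - Suc k))) + 2"
  proof -
    have eq: "2 * Suc n + 1 = Suc (Suc (2 * n + 1))" by simp
    show ?thesis
      unfolding eq sum.lessThan_Suc[of _ "Suc (2 * n + 1)"] sum.lessThan_Suc_shift[of _ "2 * n + 1"] by simp
  qed
  also have "(\<Sum>k<2 * n + 1. Suc (min (Suc k) (2 * Suc n - Suc k)))
      = (\<Sum>k<2 * n + 1. Suc (min k (2 * n - k)) + 1)"
    by (intro sum.cong) auto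
  also have "\<dots> = (n + 1) ^ 2 + (2 * n + 1)" using Suc by (simp only: sum.distrib) simp
  finally show ?case by (simp add: power2_eq_square)
qed simp

text \<open>The solutions of \<open>t ^ (P + 1) = 1\<close> are the slopes
  \<open>z ^ (P - 1)\<close>, one for each line through 0 in the plane over the prime field;
  \<open>\<Theta>\<close> selects half of them.\<close>

locale direction_set =
  fixes P m :: nat and \<Theta> :: "'a::{field,finite} set"
  assumes prime_P: "prime P" and CHAR_P: "CHAR('a) = P" and card_a: "CARD('a) = P ^ 2"
    and P_m: "P + 1 = 2 * m" and m2: "2 \<le> m" and card_\<Theta>: "card \<Theta> = m"
    and \<Theta>: "\<And>t. t \<in> \<Theta> \<Longrightarrow> t ^ (P + 1) = 1"
begin

section \<open>Frobenius and the indicator functions of lines\<close>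

lemma P_eq: "P = 2 * m - 1" and P_eq': "P = 2 * (m - 1) + 1" and P3: "3 \<le> P"
  using P_m m2 by auto

lemma fin_\<Theta>: "finite \<Theta>" by simp

lemma zero_\<Theta>: "0 \<notin> \<Theta>"
  using \<Theta>[of 0] by auto

lemma prime_CHAR_a: "prime CHAR('a)" using prime_P CHAR_P by simp

lemma of_nat_P: "(of_nat P :: 'a) = 0"
  using of_nat_CHAR[where ?'a = 'a] CHAR_P by simp

lemma frob_add: "(x + y) ^ P = x ^ P + (y :: 'a) ^ P"
  by (rule freshmans_dream[OF prime_CHAR_a CHAR_P[symmetric]])

lemma frob_diff: "(x - y) ^ P = x ^ P - (y :: 'a) ^ P"
  using frob_add[of "x - y" y] by (simp add: algebra_simps)

text \<open>Multiplication by a nonzero \<open>z\<close> permutes the nonzero elements, hence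
  preserves their product.\<close>

lemma power_q: "(z :: 'a) ^ (P * P) = z"
proof (cases "z = 0")
  case False
  have "z * (\<Prod>y\<in>UNIV-{0}. z * y) = z * z ^ (card (UNIV :: 'a set) - 1) * \<Prod>(UNIV-{0})"
    by (simp add: prod.distrib mult_ac)
  also have "z * z ^ (card (UNIV :: 'a set) - 1) = z ^ (P * P)"
    using card_a zero_less_card_finite[where ?'a = 'a]
    by (metis power2_eq_square power_minus_mult mult.commute)
  also have "(\<Prod>y\<in>UNIV-{0}. z * y) = (\<Prod>y\<in>UNIV-{0}. y)"
    by (rule prod.reindex_bij_witness[of _ "\<lambda>y. y / z" "\<lambda>y. z * y"]) (use False in auto)
  finally show ?thesis by simp
qed (use P3 in auto)

definition lin :: "'a \<Rightarrow> 'a \<Rightarrow> 'a" where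
  "lin t z = z ^ P - t * z"

lemma lin_diff: "lin t (x - y) = lin t x - lin t y"
  by (simp add: lin_def frob_diff algebra_simps)

text \<open>Off the line, \<open>L = lin t z\<close> satisfies \<open>t L ^ P = - L\<close>, because
  \<open>t ^ (P + 1) = 1\<close> and Frobenius applied twice is the identity; dividing by
  \<open>L\<close> leaves \<open>-1\<close>.\<close>

lemma line_indicator:
  assumes "t \<in> \<Theta>"
  shows "(if z ^ P = t * z then 1 else 0) - 1 = t * lin t z ^ (P - 1)"
proof (cases "lin t z = 0")
  case True
  then show ?thesis using P3 by (simp add: lin_def)
next
  case False
  have "lin t z * (t * lin t z ^ (P - 1)) = t * lin t z ^ P"
    using P3 by (metis mult.left_commute power_minus_mult mult.commute not_numeral_le_zero neq0_conv)
  also have "lin t z ^ P = z - t ^ P * z ^ P"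
    unfolding lin_def frob_diff power_mult_distrib power_mult[symmetric] power_q ..
  also have "t * (z - t ^ P * z ^ P) = t * z - t ^ (P + 1) * z ^ P" by (simp add: algebra_simps)
  also have "\<dots> = lin t z * (-1)" using \<Theta>[OF assms] by (simp add: lin_def)
  finally have "t * lin t z ^ (P - 1) = -1" using False by (simp only: mult_cancel_left) simp
  then show ?thesis using False by (simp add: lin_def)
qed

text \<open>By Frobenius \<open>(x - y) ^ P = x ^ P - y ^ P\<close>, and division by
  \<open>x - y\<close> gives the geometric sum. For \<open>x = y\<close> that sum has
  \<open>P\<close> equal terms and vanishes.\<close>

lemma power_diff_expand: "(x - y) ^ (P - 1) = (\<Sum>k<P. x ^ k * (y :: 'a) ^ (P - 1 - k))"
proof (cases "x = y")
  case True
  have "(\<Sum>k<P. y ^ k * (y :: 'a) ^ (P - 1 - k)) = (\<Sum>k<P. y ^ (P - 1))"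
    by (intro sum.cong) (auto simp flip: power_add)
  also have "\<dots> = 0" by (simp add: of_nat_P)
  finally show ?thesis using True P3 by simp
next
  case False
  have "(x - y) * (x - y) ^ (P - 1) = (x - y) ^ P"
    using P3 by (metis power_minus_mult mult.commute not_numeral_le_zero neq0_conv)
  also have "\<dots> = x ^ Suc (P - 1) - y ^ Suc (P - 1)" using P3 by (simp add: frob_diff)
  also have "\<dots> = (x - y) * (\<Sum>k<P. x ^ k * y ^ (P - 1 - k))"
    using P3 by (subst diff_power_eq_sum) simp
  finally show ?thesis using False by simp
qed

section \<open>Monomial functions and the Hankel decomposition\<close>

definition mono_vec :: "nat \<Rightarrow> ('a, 'a) vec" where
  "mono_vec i = (\<chi> z. z ^ i)"

lemma independent_mono: "independent_family mono_vec {..<P ^ 2}"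
  unfolding independent_family_def
proof (intro allI impI ballI)
  fix x i assume s: "(\<Sum>i<P ^ 2. x i *s mono_vec i) = 0" and i: "i \<in> {..<P ^ 2}"
  have "(\<Sum>i<P ^ 2. x i * t ^ i) = 0" for t
    using arg_cong[OF s, of "\<lambda>v. v $ t"] by (simp add: mono_vec_def)
  then show "x i = 0"
    using i card_a by (intro polynomial_sum_eq_0[of "UNIV :: 'a set" "P ^ 2" x]) auto
qed

text \<open>\<open>b\<close> and \<open>k - b\<close> are the base \<open>P\<close> digits of the
  exponent, so different pairs give different exponents below \<open>P ^ 2\<close>.\<close>

lemma independent_mono2:
  "independent_family (\<lambda>(k, b). mono_vec (b + P * (k - b))) (SIGMA k:{..<P}. {..k})"
proof -
  have "independent_family (\<lambda>i. mono_vec ((\<lambda>(k, b). b + P * (k - b)) i)) (SIGMA k:{..<P}. {..k})"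
  proof (rule independent_family_comp[OF independent_mono])
    show "inj_on (\<lambda>(k, b). b + P * (k - b)) (SIGMA k:{..<P}. {..k})"
    proof (rule inj_onI, clarsimp)
      fix k b k' b' assume *: "k < P" "b \<le> k" "k' < P" "b' \<le> k'" "b + P * (k - b) = b' + P * (k' - b')"
      have dm: "(i + P * j) mod P = i" "(i + P * j) div P = j" if "i < P" for i j
        using that by auto
      have "b = b'" using dm(1)[of b] dm(1)[of b'] * by (metis le_less_trans)
      moreover have "k - b = k' - b'" using dm(2)[of b] dm(2)[of b'] * by (metis le_less_trans)
      ultimately show "k = k' \<and> b = b'" using * by auto
    qed
    have "b + P * (k - b) < P ^ 2" if "k < P" "b \<le> k" for k b
    proof -
      have "P * (k - b) \<le> P * (P - 1)" using that by (intro mult_le_mono2) simp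
      then have "b + P * (k - b) < P + P * (P - 1)" using that by linarith
      also have "\<dots> = P ^ 2" using P3 by (cases P) (auto simp: power2_eq_square)
      finally show ?thesis .
    qed
    then show "(\<lambda>(k, b). b + P * (k - b)) ` (SIGMA k:{..<P}. {..k}) \<subseteq> {..<P ^ 2}" by auto
  qed simp
  then show ?thesis by (simp add: case_prod_unfold)
qed

definition coef :: "nat \<Rightarrow> nat \<Rightarrow> 'a" where
  "coef k a = of_nat (k choose a) * (-1) ^ a"

lemma coef_nonzero: "a \<le> k \<Longrightarrow> k < P \<Longrightarrow> coef k a \<noteq> 0"
proof -
  assume "a \<le> k" "k < P"
  have "\<not> P dvd (k choose a)"
  proof
    assume "P dvd (k choose a)"
    then have "P dvd fact a * fact (k - a) * (k choose a)" by (rule dvd_mult)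
    then have "P dvd fact k" using \<open>a \<le> k\<close> by (simp add: binomial_fact_lemma)
    then show False using \<open>k < P\<close> prime_P prime_dvd_fact_iff[of P k] by simp
  qed
  then show ?thesis by (simp add: coef_def of_nat_eq_0_iff_char_dvd CHAR_P)
qed

definition mono_term :: "nat \<Rightarrow> nat \<Rightarrow> ('a, 'a) vec" where
  "mono_term k a = coef k a *s mono_vec (a + P * (k - a))"

lemma lin_power: "lin t z ^ k = (\<Sum>a\<le>k. t ^ a * mono_term k a $ z)"
proof -
  have "lin t z ^ k = (- t * z + z ^ P) ^ k" by (simp add: lin_def)
  also have "\<dots> = (\<Sum>a\<le>k. of_nat (k choose a) * (- t * z) ^ a * (z ^ P) ^ (k - a))"
    by (rule binomial_ring)
  also have "\<dots> = (\<Sum>a\<le>k. t ^ a * mono_term k a $ z)"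
  proof (rule sum.cong)
    fix a
    have "(- t * z) ^ a = (-1) ^ a * t ^ a * z ^ a"
      by (metis mult_minus_left mult_1 power_mult_distrib mult.assoc)
    then show "of_nat (k choose a) * (- t * z) ^ a * (z ^ P) ^ (k - a) = t ^ a * mono_term k a $ z"
      by (simp add: mono_term_def mono_vec_def coef_def power_add power_mult mult_ac)
  qed simp
  finally show ?thesis .
qed

text \<open>The shift by one comes from the factor \<open>t\<close> in \<open>line_indicator\<close>
  and agrees with the form treated in \<open>hankel_injective\<close>.\<close>

definition hankel :: "nat \<Rightarrow> 'a" where
  "hankel j = (\<Sum>t\<in>\<Theta>. t ^ (j + 1))"

definition hankel_comb :: "nat \<Rightarrow> nat \<Rightarrow> ('a, 'a) vec" where
  "hankel_comb k a = (\<Sum>b\<le>k. hankel (a + b) *s mono_term k b)"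

text \<open>Subtracting 1 from each indicator makes every summand a homogeneous form of degree \<open>P - 1\<close>.\<close>

definition net_mod :: "(('a, 'a) vec, 'a) vec" where
  "net_mod = (\<chi> x y. \<Sum>t\<in>\<Theta>. (if (x - y) ^ P = t * (x - y) then 1 else 0) - 1)"

text \<open>Additivity of \<open>lin\<close> and \<open>power_diff_expand\<close> separate
  \<open>x\<close> from \<open>y\<close>. The summand for \<open>k\<close> is a bilinear form in
  monomials whose Hankel matrix has size \<open>k + 1\<close> by \<open>P - k\<close>.\<close>

lemma net_mod_expand:
  "net_mod $ x $ y = (\<Sum>k<P. \<Sum>a\<le>k. \<Sum>b\<le>P - 1 - k. hankel (a + b) * mono_term k a $ x * mono_term (P - 1 - k) b $ y)"
proof -
  have prod_term: "t * (lin t x ^ k * lin t y ^ n) = (\<Sum>a\<le>k. \<Sum>b\<le>n.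
      t ^ (a + b + 1) * mono_term k a $ x * mono_term n b $ y)" for t k n
    unfolding lin_power sum_product by (simp add: sum_distrib_left power_add mult_ac)
  have "net_mod $ x $ y = (\<Sum>t\<in>\<Theta>. t * lin t (x - y) ^ (P - 1))"
    unfolding net_mod_def using line_indicator by (simp cong: sum.cong)
  also have "\<dots> = (\<Sum>t\<in>\<Theta>. \<Sum>k<P. \<Sum>a\<le>k. \<Sum>b\<le>P - 1 - k.
      t ^ (a + b + 1) * mono_term k a $ x * mono_term (P - 1 - k) b $ y)"
    unfolding lin_diff power_diff_expand by (simp only: sum_distrib_left prod_term)
  also have "\<dots> = (\<Sum>k<P. \<Sum>t\<in>\<Theta>. \<Sum>a\<le>k. \<Sum>b\<le>P - 1 - k.
      t ^ (a + b + 1) * mono_term k a $ x * mono_term (P - 1 - k) b $ y)"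
    by (rule sum.swap)
  also have "\<dots> = (\<Sum>k<P. \<Sum>a\<le>k. \<Sum>t\<in>\<Theta>. \<Sum>b\<le>P - 1 - k.
      t ^ (a + b + 1) * mono_term k a $ x * mono_term (P - 1 - k) b $ y)"
    by (intro sum.cong refl sum.swap)
  also have "\<dots> = (\<Sum>k<P. \<Sum>a\<le>k. \<Sum>b\<le>P - 1 - k. \<Sum>t\<in>\<Theta>.
      t ^ (a + b + 1) * mono_term k a $ x * mono_term (P - 1 - k) b $ y)"
    by (intro sum.cong refl sum.swap)
  finally show ?thesis by (simp add: hankel_def sum_distrib_right)
qed

definition tensor_idx :: "(nat \<times> nat) set" where
  "tensor_idx = (SIGMA k:{..<P}. {..min k (P - 1 - k)})"

text \<open>One factor of a rank decomposition of the blocks: the longer side of a block takes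
  combinations given by the Hankel matrix, the shorter side the monomials themselves. The threshold
  \<open>n\<close> settles which rule applies when both sides are equal.\<close>

definition mixed :: "nat \<Rightarrow> nat \<times> nat \<Rightarrow> ('a, 'a) vec" where
  "mixed n i = (case i of (k, a) \<Rightarrow> if n \<le> k then hankel_comb k a else mono_term k a)"

text \<open>Different \<open>k\<close> involve different monomials, so each block is treated alone.
  For \<open>k\<close> at least \<open>n\<close> the monomial coefficients are Hankel sums, and
  \<open>m - 1 <= n\<close> provides the \<open>m\<close> values of \<open>b\<close> that
  \<open>hankel_injective\<close> asks for.\<close>

lemma independent_mixed:
  assumes n: "m - 1 \<le> n"
  shows "independent_family (mixed n) tensor_idx"
  unfolding independent_family_def
proof (intro allI impI)
  fix x assume s: "(\<Sum>i\<in>tensor_idx. x i *s mixed n i) = 0"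
  \<comment> \<open>The coefficient of the monomial with digits \<open>b\<close> and
    \<open>k - b\<close>.\<close>
  define u where "u k b = (if n \<le> k then (\<Sum>a\<le>P - 1 - k. x (k, a) * hankel (a + b)) * coef k b
     else if b \<le> P - 1 - k then x (k, b) * coef k b else 0)" for k b
  have row: "(\<Sum>a\<le>min k (P - 1 - k). x (k, a) *s mixed n (k, a)) = (\<Sum>b\<le>k. u k b *s mono_vec (b + P * (k - b)))"
    if "k < P" for k
  proof (cases "n \<le> k")
    case True
    then have "min k (P - 1 - k) = P - 1 - k" using n P_eq by simp
    then have "(\<Sum>a\<le>min k (P - 1 - k). x (k, a) *s mixed n (k, a))
        = (\<Sum>a\<le>P - 1 - k. \<Sum>b\<le>k. (x (k, a) * hankel (a + b) * coef k b) *s mono_vec (b + P * (k - b)))"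
      using True by (simp add: mixed_def hankel_comb_def mono_term_def vec.scale_sum_right vector_smult_assoc mult.assoc)
    also have "\<dots> = (\<Sum>b\<le>k. \<Sum>a\<le>P - 1 - k. (x (k, a) * hankel (a + b) * coef k b) *s mono_vec (b + P * (k - b)))"
      by (rule sum.swap)
    finally show ?thesis
      using True by (simp add: u_def sum_distrib_right vec.scale_sum_left)
  next
    case False
    have "(\<Sum>b\<le>k. u k b *s mono_vec (b + P * (k - b))) = (\<Sum>b\<le>min k (P - 1 - k). u k b *s mono_vec (b + P * (k - b)))"
      using False by (intro sum.mono_neutral_right) (auto simp: u_def)
    then show ?thesis using False
      by (simp add: u_def mixed_def mono_term_def vector_smult_assoc)
  qed
  have "(\<Sum>i\<in>(SIGMA k:{..<P}. {..k}). (case i of (k, b) \<Rightarrow> u k b) *s (case i of (k, b) \<Rightarrow> mono_vec (b + P * (k - b))))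
      = (\<Sum>k<P. \<Sum>b\<le>k. u k b *s mono_vec (b + P * (k - b)))"
    by (subst sum.Sigma) (auto intro!: sum.cong)
  also have "\<dots> = (\<Sum>k<P. \<Sum>a\<le>min k (P - 1 - k). x (k, a) *s mixed n (k, a))"
    by (rule sum.cong[OF refl], rule row[symmetric]) simp
  also have "\<dots> = 0"
    using s unfolding tensor_idx_def by (subst sum.Sigma) (auto simp: case_prod_unfold)
  finally have u0: "u k b = 0" if "k < P" "b \<le> k" for k b
    using independent_familyD[OF independent_mono2, of "\<lambda>(k, b). u k b" "(k, b)"] that by auto
  have "x (k, a) = 0" if k: "k < P" and a: "a \<le> min k (P - 1 - k)" for k a
  proof (cases "n \<le> k")
    case True
    have "(\<Sum>a\<le>P - 1 - k. x (k, a) * hankel (a + b)) = 0" if "b \<le> k" for b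
      using u0[OF k that] coef_nonzero[OF that k] True by (simp add: u_def)
    then have h: "(\<Sum>a<P - k. x (k, a) * (\<Sum>t\<in>\<Theta>. t ^ (a + b + 1))) = 0" if "b < card \<Theta>" for b
      using that True n k card_\<Theta> by (simp add: hankel_def lessThan_Suc_atMost[symmetric] Suc_diff_Suc)
    show ?thesis
      by (rule hankel_injective[OF fin_\<Theta> zero_\<Theta> _ h]) (use True n k a card_\<Theta> P_eq in auto)
  next
    case False
    then show ?thesis using u0[OF k, of a] a coef_nonzero[of a k] k by (simp add: u_def)
  qed
  then show "\<forall>i\<in>tensor_idx. x i = 0" unfolding tensor_idx_def by auto
qed

text \<open>The thresholds \<open>m\<close> and \<open>m - 1\<close> are complementary under the
  reflection of \<open>k\<close> to \<open>P - 1 - k\<close>, so in every block exactly one factor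
  absorbs the Hankel matrix, and the rank is the number of index pairs.\<close>

theorem rank_net_mod: "vec.dim (range ((*v) net_mod)) = m ^ 2"
proof -
  have fin: "finite tensor_idx" by (simp add: tensor_idx_def)
  let ?\<phi> = "\<lambda>(k, a). (P - 1 - k, a :: nat)"
  have ind: "independent_family (\<lambda>i. mixed (m - 1) (?\<phi> i)) tensor_idx"
    by (rule independent_family_comp[OF independent_mixed]) (auto simp: tensor_idx_def inj_on_def)
  have M: "net_mod $ x $ y = (\<Sum>i\<in>tensor_idx. mixed m i $ x * mixed (m - 1) (?\<phi> i) $ y)" for x y
  proof -
    have row: "(\<Sum>a\<le>k. \<Sum>b\<le>P - 1 - k. hankel (a + b) * mono_term k a $ x * mono_term (P - 1 - k) b $ y)
      = (\<Sum>a\<le>min k (P - 1 - k). mixed m (k, a) $ x * mixed (m - 1) (P - 1 - k, a) $ y)" if "k < P" for k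
    proof (cases "m \<le> k")
      case True
      then have *: "min k (P - 1 - k) = P - 1 - k" "\<not> m - 1 \<le> P - 1 - k" using P_eq that m2 by auto
      show ?thesis
        unfolding * using True *(2)
        by (subst sum.swap) (simp add: mixed_def hankel_comb_def sum_distrib_right add.commute)
    next
      case False
      then have *: "min k (P - 1 - k) = k" "m - 1 \<le> P - 1 - k" using P_eq m2 by auto
      show ?thesis
        unfolding * using False *(2)
        by (simp add: mixed_def hankel_comb_def sum_distrib_left mult_ac)
    qed
    have "net_mod $ x $ y = (\<Sum>k<P. \<Sum>a\<le>min k (P - 1 - k). mixed m (k, a) $ x * mixed (m - 1) (P - 1 - k, a) $ y)"
      unfolding net_mod_expand by (rule sum.cong[OF refl], rule row) simp
    also have "\<dots> = (\<Sum>i\<in>tensor_idx. mixed m i $ x * mixed (m - 1) (?\<phi> i) $ y)"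
      unfolding tensor_idx_def by (subst sum.Sigma) (auto simp: case_prod_unfold)
    finally show ?thesis .
  qed
  have "vec.dim (range ((*v) net_mod)) = card tensor_idx"
    by (rule dim_range_tensor_sum[OF independent_mixed ind fin M]) simp
  also have "\<dots> = (\<Sum>k<2 * (m - 1) + 1. Suc (min k (2 * (m - 1) - k)))"
    unfolding tensor_idx_def using P_eq' by (subst card_SigmaI) auto
  also have "\<dots> = m ^ 2" unfolding sum_min_eq_square using m2 by simp
  finally show ?thesis .
qed

end

section \<open>Nets of parallel lines\<close>

lemma of_nat_vec_nth [simp]: "(of_nat n :: 'b::semiring_1 ^ 'n) $ i = of_nat n"
  by (induction n) auto

section \<open>Lines through 0 as complementary subgroups\<close>

context direction_set
begin

definition line :: "'a \<Rightarrow> 'a set" where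
  "line t = {z. z ^ P = t * z}"

lemma line_add: "x \<in> line t \<Longrightarrow> y \<in> line t \<Longrightarrow> x + y \<in> line t"
  and line_diff: "x \<in> line t \<Longrightarrow> y \<in> line t \<Longrightarrow> x - y \<in> line t"
  by (simp_all add: line_def frob_add frob_diff algebra_simps)

text \<open>A point on both lines satisfies \<open>t z = u z\<close>, so it is 0. Conversely, the
  parts of \<open>w\<close> solve the linear system \<open>a + b = w\<close>,
  \<open>t a + u b = w ^ P\<close>.\<close>

lemma line_product:
  assumes t: "t \<in> \<Theta>" and u: "u \<in> \<Theta>" and ne: "t \<noteq> u"
  shows "bij_betw (\<lambda>(a, b). a + b) (line t \<times> line u) UNIV"
proof -
  have t1: "t * t ^ P = 1" and u1: "u * u ^ P = 1" using \<Theta>[OF t] \<Theta>[OF u] by simp_all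
  have "inj_on (\<lambda>(a, b). a + b) (line t \<times> line u)"
  proof (rule inj_onI, clarsimp)
    fix a b a' b' assume *: "a \<in> line t" "b \<in> line u" "a' \<in> line t" "b' \<in> line u" "a + b = a' + b'"
    then have d: "a - a' \<in> line t" "b' - b \<in> line u" "a - a' = b' - b"
      by (auto intro: line_diff simp: algebra_simps)
    then have "t * (a - a') = u * (a - a')" by (simp add: line_def)
    then have "a - a' = 0" using ne by (metis mult_cancel_right)
    then show "a = a' \<and> b = b'" using d by simp
  qed
  moreover have "\<exists>a\<in>line t. \<exists>b\<in>line u. w = a + b" for w
  proof -
    define e where "e = t - u"
    have e: "e \<noteq> 0" "e ^ P \<noteq> 0" using ne by (auto simp: e_def)
    have eP: "e ^ P = t ^ P - u ^ P" by (simp add: e_def frob_diff)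
    have wP: "(w ^ P) ^ P = w" using power_q[of w] by (simp add: power_mult)
    have "(w ^ P - u * w) / e \<in> line t"
    proof -
      have "(w ^ P - u * w) ^ P * e = t * (w ^ P - u * w) * e ^ P"
      proof -
        have "(w ^ P - u * w) ^ P * e = t * w - u * w - t * u ^ P * w ^ P + (u * u ^ P) * w ^ P"
          unfolding frob_diff power_mult_distrib wP e_def by (simp add: algebra_simps)
        also have "\<dots> = (t * t ^ P) * w ^ P - u * w * (t * t ^ P) - t * u ^ P * w ^ P + t * w * (u * u ^ P)"
          unfolding t1 u1 by (simp add: algebra_simps)
        also have "\<dots> = t * (w ^ P - u * w) * e ^ P" unfolding eP by (simp add: algebra_simps)
        finally show ?thesis .
      qed
      then show ?thesis using e by (simp add: line_def power_divide field_simps)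
    qed
    moreover have "(t * w - w ^ P) / e \<in> line u"
    proof -
      have "(t * w - w ^ P) ^ P * e = u * (t * w - w ^ P) * e ^ P"
      proof -
        have "(t * w - w ^ P) ^ P * e = (t * t ^ P) * w ^ P - t * w + u * w - u * t ^ P * w ^ P"
          unfolding frob_diff power_mult_distrib wP e_def by (simp add: algebra_simps)
        also have "\<dots> = (u * u ^ P) * w ^ P - t * w * (u * u ^ P) + u * w * (t * t ^ P) - u * t ^ P * w ^ P"
          unfolding t1 u1 by (simp add: algebra_simps)
        also have "\<dots> = u * (t * w - w ^ P) * e ^ P" unfolding eP by (simp add: algebra_simps)
        finally show ?thesis .
      qed
      then show ?thesis using e by (simp add: line_def power_divide field_simps)
    qed
    moreover have "w = (w ^ P - u * w) / e + (t * w - w ^ P) / e"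
    proof -
      have "(w ^ P - u * w) + (t * w - w ^ P) = e * w" by (simp add: e_def algebra_simps)
      then show ?thesis using e(1) by (simp only: add_divide_distrib[symmetric]) simp
    qed
    ultimately show ?thesis by blast
  qed
  ultimately show ?thesis unfolding bij_betw_def by (auto simp: image_iff)
qed

lemma card_line_le: "card (line t) \<le> P"
proof -
  let ?f = "Polynomial.monom 1 P - [:0, t:]"
  have "poly.coeff ?f P = 1" using P3 by (simp add: coeff_pCons split: nat.split)
  then have nz: "?f \<noteq> 0" by (metis coeff_0 zero_neq_one)
  have "degree ?f \<le> P" using P3 by (intro degree_diff_le) (auto simp: degree_monom_eq)
  moreover have "line t = {z. poly ?f z = 0}" by (auto simp: line_def poly_monom mult.commute)
  ultimately show ?thesis using card_poly_roots_bound[OF nz] by simp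
qed

text \<open>Two lines of different slopes have at most \<open>P\<close> points each, and the product
  of their sizes is \<open>P * P\<close>.\<close>

lemma card_line: "t \<in> \<Theta> \<Longrightarrow> card (line t) = P"
proof -
  assume t: "t \<in> \<Theta>"
  have "\<Theta> \<noteq> {t}" using card_\<Theta> m2 by auto
  then obtain u where u: "u \<in> \<Theta>" "t \<noteq> u" using t by auto
  have "card (line t) * card (line u) = P * P"
    using bij_betw_same_card[OF line_product[OF t u]] card_a
    by (simp add: card_cartesian_product power2_eq_square)
  moreover have "card (line t) * card (line u) < P * P" if "card (line t) \<noteq> P"
  proof -
    have "card (line t) * card (line u) \<le> (P - 1) * P"
      using that card_line_le[of t] card_line_le[of u] by (intro mult_le_mono) auto
    also have "\<dots> < P * P" using P3 by simp
    finally show ?thesis .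
  qed
  ultimately show ?thesis by force
qed

section \<open>Convolution with lines\<close>

definition line_sum :: "'a \<Rightarrow> (int, 'a) vec \<Rightarrow> (int, 'a) vec" where
  "line_sum t v = (\<chi> x. \<Sum>z\<in>line t. v $ (x - z))"

lemma line_sum_add: "line_sum t (u + v) = line_sum t u + line_sum t v"
  and line_sum_diff: "line_sum t (u - v) = line_sum t u - line_sum t v"
  and line_sum_smult: "line_sum t (c *s u) = c *s line_sum t u"
  by (simp_all add: line_sum_def vec_eq_iff sum.distrib sum_subtractf sum_distrib_left)

lemma line_sum_sum: "line_sum t (\<Sum>i\<in>I. f i) = (\<Sum>i\<in>I. line_sum t (f i))"
proof -
  have "line_sum t 0 = 0" by (simp add: line_sum_def vec_eq_iff)
  then show ?thesis by (induction I rule: infinite_finite_induct) (auto simp: line_sum_add)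
qed

lemma total_shift: "(\<Sum>z\<in>UNIV. v $ (x - z)) = total v" for x :: 'a
  unfolding total_def by (rule sum.reindex_bij_witness[of _ "\<lambda>y. x - y" "\<lambda>z. x - z"]) auto

lemma line_sum_same:
  assumes "t \<in> \<Theta>" shows "line_sum t (line_sum t v) = int P *s line_sum t v"
proof -
  have "(\<Sum>z\<in>line t. \<Sum>w\<in>line t. v $ (x - z - w)) = int P * (\<Sum>w\<in>line t. v $ (x - w))" for x
  proof -
    have "(\<Sum>w\<in>line t. v $ (x - z - w)) = (\<Sum>w\<in>line t. v $ (x - w))" if "z \<in> line t" for z
      using that
      by (intro sum.reindex_bij_witness[of _ "\<lambda>w. w - z" "\<lambda>w. w + z"])
         (auto intro: line_add line_diff simp: algebra_simps)
    then have "(\<Sum>z\<in>line t. \<Sum>w\<in>line t. v $ (x - z - w)) = (\<Sum>z\<in>line t. \<Sum>w\<in>line t. v $ (x - w))"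
      by (rule sum.cong[OF refl])
    then show ?thesis using card_line[OF assms] by simp
  qed
  then show ?thesis by (simp add: line_sum_def vec_eq_iff)
qed

lemma line_sum_distinct:
  assumes "t \<in> \<Theta>" "u \<in> \<Theta>" "t \<noteq> u" shows "line_sum t (line_sum u v) = total v *s 1"
proof -
  have "(\<Sum>z\<in>line t. \<Sum>w\<in>line u. v $ (x - z - w)) = total v" for x
  proof -
    have "(\<Sum>z\<in>line t. \<Sum>w\<in>line u. v $ (x - z - w)) = (\<Sum>i\<in>line t \<times> line u. v $ (x - (case i of (a, b) \<Rightarrow> a + b)))"
      by (simp add: sum.cartesian_product case_prod_unfold algebra_simps)
    also have "\<dots> = (\<Sum>z\<in>UNIV. v $ (x - z))"
      using sum.reindex_bij_betw[OF line_product[OF assms], of "\<lambda>z. v $ (x - z)"] .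
    finally show ?thesis by (simp add: total_shift)
  qed
  then show ?thesis by (simp add: line_sum_def vec_eq_iff)
qed

lemma line_sum_one: "t \<in> \<Theta> \<Longrightarrow> line_sum t 1 = int P *s 1"
  by (simp add: line_sum_def vec_eq_iff card_line)

lemma total_line_sum: "t \<in> \<Theta> \<Longrightarrow> total (line_sum t v) = int P * total v"
proof -
  assume t: "t \<in> \<Theta>"
  have "total (line_sum t v) = (\<Sum>z\<in>line t. \<Sum>x\<in>UNIV. v $ (x - z))"
    unfolding total_def line_sum_def by simp (rule sum.swap)
  also have "\<dots> = (\<Sum>z\<in>line t. total v)"
    unfolding total_def
    by (intro sum.cong refl sum.reindex_bij_witness[of _ "\<lambda>x. x + _" "\<lambda>x. x - _"]) auto
  finally show ?thesis using card_line[OF t] by simp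
qed

definition net :: "((int, 'a) vec, 'a) vec" where
  "net = (\<chi> x y. \<Sum>t\<in>\<Theta>. (if (x - y) ^ P = t * (x - y) then 1 else 0) - 1)"

lemma redm_net: "redm net = net_mod"
  by (simp add: redm_def net_def net_mod_def vec_eq_iff if_distrib[where f = of_int] cong: if_cong)

definition lines_sum :: "(int, 'a) vec \<Rightarrow> (int, 'a) vec" where
  "lines_sum v = (\<Sum>t\<in>\<Theta>. line_sum t v)"

lemma net_mult: "net *v v = lines_sum v - (int m * total v) *s 1"
proof -
  have "(net *v v) $ x = (lines_sum v - (int m * total v) *s 1) $ x" for x
  proof -
    have ls: "(\<Sum>y\<in>UNIV. (if (x - y) ^ P = t * (x - y) then 1 else 0) * v $ y) = line_sum t v $ x" for t
    proof -
      have "(\<Sum>y\<in>UNIV. (if (x - y) ^ P = t * (x - y) then 1 else 0) * v $ y) = (\<Sum>y | x - y \<in> line t. v $ y)"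
        by (simp add: line_def if_distrib[where f = "\<lambda>c. c * _"] sum.If_cases cong: if_cong)
      also have "\<dots> = (\<Sum>z\<in>line t. v $ (x - z))"
        by (rule sum.reindex_bij_witness[of _ "\<lambda>z. x - z" "\<lambda>y. x - y"]) auto
      finally show ?thesis by (simp add: line_sum_def)
    qed
    have "(net *v v) $ x = (\<Sum>y\<in>UNIV. \<Sum>t\<in>\<Theta>. (if (x - y) ^ P = t * (x - y) then 1 else 0) * v $ y - v $ y)"
      by (simp add: net_def matrix_vector_mult_def sum_distrib_right left_diff_distrib)
    also have "\<dots> = (\<Sum>t\<in>\<Theta>. \<Sum>y\<in>UNIV. (if (x - y) ^ P = t * (x - y) then 1 else 0) * v $ y - v $ y)"
      by (rule sum.swap)
    also have "\<dots> = (\<Sum>t\<in>\<Theta>. line_sum t v $ x - total v)"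
      by (intro sum.cong refl) (simp only: sum_subtractf ls total_def)
    also have "\<dots> = (lines_sum v - (int m * total v) *s 1) $ x"
      by (simp add: sum_subtractf lines_sum_def card_\<Theta>)
    finally show ?thesis .
  qed
  then show ?thesis by (simp add: vec_eq_iff)
qed

lemma lines_sum_diff: "lines_sum (u - v) = lines_sum u - lines_sum v"
  and lines_sum_smult: "lines_sum (c *s u) = c *s lines_sum u"
  by (simp_all add: lines_sum_def line_sum_diff line_sum_smult sum_subtractf vec.scale_sum_right)
     (simp add: vec_eq_iff sum_distrib_left)

lemma lines_sum_one: "lines_sum 1 = (int m * int P) *s 1"
proof -
  have "lines_sum 1 = (\<Sum>t\<in>\<Theta>. int P *s 1)" unfolding lines_sum_def using line_sum_one by (intro sum.cong) auto
  then show ?thesis by (simp add: vec_eq_iff card_\<Theta>)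
qed

lemma total_lines_sum: "total (lines_sum v) = int m * int P * total v"
proof -
  have "total (lines_sum v) = (\<Sum>t\<in>\<Theta>. int P * total v)"
    unfolding lines_sum_def total_sum using total_line_sum by (intro sum.cong) auto
  then show ?thesis by (simp add: card_\<Theta>)
qed

text \<open>Among the products of two line operators, those with equal slopes give the multiple by
  \<open>P\<close>, and each of the \<open>m (m - 1)\<close> others gives
  \<open>total v *s 1\<close>.\<close>

lemma lines_sum_twice: "lines_sum (lines_sum v) = int P *s lines_sum v + (int m * (int m - 1) * total v) *s 1"
proof -
  have "line_sum t (lines_sum v) = int P *s line_sum t v + ((int m - 1) * total v) *s 1" if t: "t \<in> \<Theta>" for t
  proof -
    have "line_sum t (lines_sum v) = line_sum t (line_sum t v) + (\<Sum>u\<in>\<Theta> - {t}. line_sum t (line_sum u v))"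
      unfolding lines_sum_def line_sum_sum using t by (subst sum.remove[of _ t]) auto
    also have "(\<Sum>u\<in>\<Theta> - {t}. line_sum t (line_sum u v)) = (\<Sum>u\<in>\<Theta> - {t}. total v *s 1)"
      using t line_sum_distinct by (intro sum.cong) auto
    also have "\<dots> = ((int m - 1) * total v) *s 1"
      using t card_\<Theta> m2 by (simp add: vec_eq_iff of_nat_diff)
    finally show ?thesis using line_sum_same[OF t] by simp
  qed
  then have "lines_sum (lines_sum v) = (\<Sum>t\<in>\<Theta>. int P *s line_sum t v + ((int m - 1) * total v) *s 1)"
    unfolding lines_sum_def[of "lines_sum v"] by (intro sum.cong) auto
  also have "\<dots> = int P *s lines_sum v + (int m * (int m - 1) * total v) *s 1"
    by (simp add: vec_eq_iff lines_sum_def sum.distrib sum_distrib_left card_\<Theta>)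
  finally show ?thesis .
qed

text \<open>Chosen so that \<open>r * P\<close> is the row sum of \<open>net\<close>:
  \<open>P\<close> from each of \<open>m\<close> lines, minus \<open>m\<close> in each of
  \<open>P ^ 2\<close> columns.\<close>

definition r where "r = int m - int m * int P"

lemma net_matrix_net: "net_matrix (int P) r net"
proof
  show "prime (int P)" using prime_P by simp
  show "int CARD('a) = int P ^ 2" using card_a by simp
  have P: "int P = 2 * int m - 1" using P_m by simp
  show "\<not> int P dvd r * (r - 1)"
  proof
    assume "int P dvd r * (r - 1)"
    \<comment> \<open>As \<open>2 * m = P + 1\<close>, modulo \<open>P\<close> the number
      \<open>r\<close> is one half, so \<open>4 * (r * (r - 1))\<close> is
      \<open>-1\<close>.\<close>
    then have "int P dvd 4 * (r * (r - 1))" by simp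
    also have "4 * (r * (r - 1)) = int P * (int P + 4 * (int m ^ 2 * int P - 2 * int m ^ 2 + int m)) - 1"
      unfolding r_def P by (simp add: algebra_simps power2_eq_square)
    finally have "int P dvd int P * (int P + 4 * (int m ^ 2 * int P - 2 * int m ^ 2 + int m)) - 1" .
    then have "int P dvd 1" by (metis dvd_triv_left dvd_diff_right_iff)
    then show False using P3 by simp
  qed
  show "net *v (net *v v) = int P *s (net *v v) + (r * (r - 1) * total v) *s 1" for v
    unfolding net_mult lines_sum_diff lines_sum_smult lines_sum_twice lines_sum_one total_diff total_smult
      total_lines_sum
    by (simp add: vec_eq_iff r_def algebra_simps total_def card_a power2_eq_square)
  have tot1: "total (1 :: (int, 'a) vec) = int P ^ 2" by (simp add: total_def card_a)
  show "net *v 1 = (r * int P) *s 1"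
    unfolding net_mult lines_sum_one tot1 by (simp add: vec_eq_iff r_def algebra_simps power2_eq_square)
  show "total (net *v v) = r * int P * total v" for v
    unfolding net_mult total_diff total_smult total_lines_sum tot1
    by (simp add: r_def algebra_simps power2_eq_square)
qed

text \<open>The rank \<open>m ^ 2\<close> gives \<open>c = m ^ 2 - 2\<close>. The diagonal of
  \<open>net\<close> is zero, so the trace condition holds with \<open>s = m (P - 1)\<close>, and
  the bound on \<open>c\<close> amounts to \<open>(m - 1) ^ 2 > 0\<close>.\<close>

lemma normal_basis_net:
  "\<exists>a w y k l. P ^ 2 = 3 + 2 * (m ^ 2 - 2) + a + a \<and> net_matrix.adapted (int P) net w y k l
    \<and> int_span (fam net w y k l) (Idx (m ^ 2 - 2) a a) = UNIV"
proof -
  interpret net_matrix "int P" r net by (rule net_matrix_net)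
  have m4: "4 \<le> m ^ 2" using power_mono[OF m2, of 2] by simp
  have P: "int P = 2 * int m - 1" using P_m by simp
  have "vec.dim (range (\<lambda>v. redm net *v (v :: ('a, 'a) vec))) = (m ^ 2 - 2) + 2"
    using rank_net_mod m4 by (simp add: redm_net)
  moreover have "trace net = int P * (r + int m * (int P - 1))"
    using P3 by (simp add: trace_def net_def r_def algebra_simps)
  moreover have "2 * (int m * (int P - 1)) = int P ^ 2 - 1"
    by (simp add: P algebra_simps power2_eq_square)
  moreover have "int (m ^ 2 - 2) < int m * (int P - 1) - 1"
  proof -
    have "0 < (int m - 1) * (int m - 1)" using m2 by (intro mult_pos_pos) auto
    then show ?thesis using m4 by (simp add: of_nat_diff P algebra_simps power2_eq_square)
  qed
  ultimately show ?thesis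
    using exists_normal_basis[where ?'k = 'a, of "m ^ 2 - 2" "int m * (int P - 1)"] CHAR_P card_a by auto
qed

section \<open>Adjacency matrices of nets\<close>

definition adj :: "((int, 'a) vec, 'a) vec" where
  "adj = (\<chi> x y. if x \<noteq> y \<and> (x - y) ^ (P - 1) \<in> \<Theta> then 1 else 0)"

text \<open>Entrywise \<open>adj = net + m (J - I)\<close> with \<open>J\<close> the all-one matrix:
  off the diagonal at most one slope fits, on it every slope does.\<close>

lemma adj_mult: "adj *v v = net *v v + int m *s (total v *s 1 - v)"
proof -
  have entry: "adj $ x $ y = net $ x $ y + (int m - (if x = y then int m else 0))" for x y
  proof (cases "x = y")
    case True
    then show ?thesis using P3 by (simp add: adj_def net_def)
  next
    case False
    define z where "z = x - y"
    have z: "z \<noteq> 0" using False by (simp add: z_def)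
    have "z ^ P = z ^ (P - 1) * z" using P3 by (metis power_minus_mult not_numeral_le_zero neq0_conv)
    then have "(z ^ P = t * z) = (t = z ^ (P - 1))" for t using z by auto
    then have "net $ x $ y = (\<Sum>t\<in>\<Theta>. (if t = z ^ (P - 1) then 1 else 0) - 1)"
      by (simp add: net_def z_def)
    then show ?thesis
      using False by (simp add: adj_def sum_subtractf card_\<Theta> z_def)
  qed
  have "(adj *v v) $ x = (net *v v + int m *s (total v *s 1 - v)) $ x" for x
  proof -
    have "(adj *v v) $ x = (\<Sum>y\<in>UNIV. net $ x $ y * v $ y + (int m * v $ y - (if x = y then int m * v $ y else 0)))"
      unfolding matrix_vector_mult_def entry
      by (simp add: algebra_simps) (intro sum.cong refl, auto simp: algebra_simps)
    then show ?thesis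
      by (simp add: sum.distrib sum_subtractf matrix_vector_mult_def total_def sum_distrib_left algebra_simps)
  qed
  then show ?thesis by (simp add: vec_eq_iff)
qed

end

text \<open>Both nets have \<open>c = m ^ 2 - 2\<close>, and counting dimensions forces equal
  \<open>a\<close>, so the two normal bases carry the same labels. The correction terms are
  respected since \<open>C\<close> fixes \<open>1\<close> and preserves
  \<open>total\<close>.\<close>

lemma adj_similar:
  assumes "direction_set P m (\<Theta> :: 'a::{field,finite} set)" and "direction_set P m (\<Theta>' :: 'a set)"
  shows "\<exists>C C' :: ((int, 'a) vec, 'a) vec. C ** C' = mat 1 \<and> C' ** C = mat 1
    \<and> C ** direction_set.adj P \<Theta> = direction_set.adj P \<Theta>' ** C"
proof -
  interpret A: direction_set P m \<Theta> by fact
  interpret B: direction_set P m \<Theta>' by fact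
  obtain a w y k l where a: "P ^ 2 = 3 + 2 * (m ^ 2 - 2) + a + a" "net_matrix.adapted (int P) A.net w y k l"
    "int_span (fam A.net w y k l) (Idx (m ^ 2 - 2) a a) = UNIV" using A.normal_basis_net by blast
  obtain a' w' y' k' l' where b: "P ^ 2 = 3 + 2 * (m ^ 2 - 2) + a' + a'" "net_matrix.adapted (int P) B.net w' y' k' l'"
    "int_span (fam B.net w' y' k' l') (Idx (m ^ 2 - 2) a' a') = UNIV" using B.normal_basis_net by blast
  have "a' = a" using a(1) b(1) by linarith
  have "\<exists>C C'. C ** C' = mat 1 \<and> C' ** C = mat 1 \<and> C ** A.net = B.net ** C \<and> C *v 1 = 1
    \<and> (\<forall>v. total (C *v v) = total v)"
    using similar_if_normal_bases[OF A.net_matrix_net B.net_matrix_net _ a(2,3) b(2,3)[unfolded \<open>a' = a\<close>]]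
      a(1) A.card_a by simp
  then obtain C C' where C: "C ** C' = mat 1" "C' ** C = mat 1" "C ** A.net = B.net ** C" "C *v 1 = 1"
    "\<And>v. total (C *v v) = total v" by blast
  have "C *v (A.adj *v v) = B.adj *v (C *v v)" for v
  proof -
    have "C *v (A.net *v v) = B.net *v (C *v v)" using C(3) by (simp add: matrix_vector_mul_assoc)
    then show ?thesis
      unfolding A.adj_mult B.adj_mult matrix_vector_right_distrib matrix_vector_mult_diff_distrib
        matrix_vector_mult_smult C(4,5) by simp
  qed
  then have "C ** A.adj = B.adj ** C" by (simp add: matrix_eq matrix_vector_mul_assoc)
  with C show ?thesis by blast
qed

section \<open>The Paley and Peisert graphs\<close>

text \<open>Translation by 1 permutes the field; summing all elements shows that
  \<open>CARD('a)\<close> is zero in it.\<close>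

lemma CHAR_prime_square:
  assumes "prime p" and "CARD('a::{field,finite}) = p ^ 2"
  shows "CHAR('a) = p"
proof -
  have "(\<Sum>x\<in>UNIV. x + 1) = (\<Sum>x\<in>UNIV. x :: 'a)"
    by (rule sum.reindex_bij_witness[of _ "\<lambda>x. x - 1" "\<lambda>x. x + 1"]) auto
  then have "of_nat CARD('a) = (0 :: 'a)" by (simp add: sum.distrib)
  then have "CHAR('a) dvd p" using assms(2) by (simp add: of_nat_eq_0_iff_char_dvd)
  moreover have "prime CHAR('a)"
    by (rule prime_CHAR_semidom) (rule finite_imp_CHAR_pos, simp)
  ultimately show ?thesis using assms(1) by (metis primes_dvd_imp_eq)
qed

lemma similar_over_if_similar_int:
  fixes D :: "'b::field set" and A B C C' :: "int ^ 'n ^ 'n"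
  assumes D: "range of_int \<subseteq> D" and C: "C ** C' = mat 1" "C' ** C = mat 1" "C ** A = B ** C"
  shows "similar_over D (redm A) (redm B)"
proof -
  have in_D: "redm M \<in> matrices_over D" for M :: "int ^ 'n ^ 'n"
    using D by (auto simp: matrices_over_def redm_def)
  have inv: "redm C ** redm C' = (mat 1 :: 'b ^ 'n ^ 'n)" "redm C' ** redm C = (mat 1 :: 'b ^ 'n ^ 'n)"
    by (simp_all add: redm_mult[symmetric] C redm_mat)
  have "C ** A ** C' = B" by (simp add: C(3) matrix_mul_assoc[symmetric] C(1))
  then have "redm C ** redm A ** redm C' = (redm B :: 'b ^ 'n ^ 'n)" by (simp add: redm_mult[symmetric])
  with inv show ?thesis unfolding similar_over_def using in_D by blast
qed

lemma number_field_Rats: "number_field \<rat>"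
proof -
  interpret Q: module "\<lambda>(r::rat) (z::complex). of_rat r * z"
    by unfold_locales (auto simp: algebra_simps of_rat_add of_rat_mult)
  have "module.span (\<lambda>(r::rat) (z::complex). of_rat r * z) {1} = \<rat>"
    by (auto simp: Q.span_singleton Rats_def)
  then show ?thesis unfolding number_field_def by (auto intro!: exI[of _ "{1}"])
qed

lemma of_int_ring_of_integers: "range of_int \<subseteq> ring_of_integers \<rat>"
  by (auto simp: ring_of_integers_def)

lemma of_int_localized_integers:
  assumes "prime l" shows "range of_int \<subseteq> localized_integers l"
proof -
  have "\<not> int l dvd 1" using prime_gt_1_nat[OF assms] by auto
  then have "\<exists>a b. of_int z = (of_int a / of_int b :: rat) \<and> \<not> int l dvd b" for z
    by (intro exI[of _ z] exI[of _ 1]) simp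
  then show ?thesis unfolding localized_integers_def by auto
qed

section \<open>Exponents of a primitive element\<close>

locale primitive_setting =
  fixes p n :: nat and \<beta> :: "'a::{field,finite}"
  assumes prime_p: "prime p" and p_n: "p + 1 = 4 * n" and card_a: "CARD('a) = p ^ 2"
    and prim: "primitive_element \<beta>"
begin

definition N where "N = (p - 1) * (p + 1)"

lemma N_eq: "Suc N = p ^ 2" and N_pos: "0 < N" and four_N: "4 dvd N" and p1: "0 < p - 1"
proof -
  have "1 < p" using prime_p by (rule prime_gt_1_nat)
  then show "0 < p - 1" "0 < N" by (auto simp: N_def)
  obtain p' where "p = Suc p'" using \<open>1 < p\<close> by (cases p) auto
  then show "Suc N = p ^ 2" unfolding N_def by (simp add: power2_eq_square)
  show "4 dvd N" unfolding N_def p_n by simp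
qed

lemma powers: "x \<noteq> 0 \<Longrightarrow> \<exists>k. x = \<beta> ^ k"
  using prim unfolding primitive_element_def by blast

lemma beta_nonzero: "\<beta> \<noteq> 0"
proof -
  have "\<beta> ^ 1 \<in> UNIV - {0}" using prim unfolding primitive_element_def by blast
  then show ?thesis by simp
qed

lemma beta_N: "\<beta> ^ N = 1"
proof -
  have "\<beta> ^ N * (\<Prod>y\<in>UNIV-{0}. y) = (\<Prod>y\<in>UNIV-{0}. \<beta> * y)"
    using card_a by (simp add: prod.distrib card_Diff_singleton flip: N_eq)
  also have "\<dots> = (\<Prod>y\<in>UNIV-{0}. y)"
    by (rule prod.reindex_bij_witness[of _ "\<lambda>y. y / \<beta>" "\<lambda>y. \<beta> * y"]) (use beta_nonzero in auto)
  finally show ?thesis by simp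
qed

lemma beta_mod: "\<beta> ^ k = \<beta> ^ (k mod N)"
proof -
  have "\<beta> ^ k = \<beta> ^ (N * (k div N) + k mod N)" by simp
  also have "\<dots> = \<beta> ^ (k mod N)" by (simp only: power_add power_mult beta_N) simp
  finally show ?thesis .
qed

lemma beta_inj: "inj_on (\<lambda>k. \<beta> ^ k) {..<N}"
proof (rule eq_card_imp_inj_on)
  have "(\<lambda>k. \<beta> ^ k) ` {..<N} = UNIV - {0}"
  proof
    show "(\<lambda>k. \<beta> ^ k) ` {..<N} \<subseteq> UNIV - {0}" using beta_nonzero by auto
    show "UNIV - {0} \<subseteq> (\<lambda>k. \<beta> ^ k) ` {..<N}"
    proof
      fix x assume "x \<in> UNIV - {0 :: 'a}"
      then obtain k where "x = \<beta> ^ k" using powers by auto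
      then have "x = \<beta> ^ (k mod N)" by (simp only: beta_mod[of k])
      then show "x \<in> (\<lambda>k. \<beta> ^ k) ` {..<N}" using N_pos by (intro image_eqI[of _ _ "k mod N"]) auto
    qed
  qed
  then show "card ((\<lambda>k. \<beta> ^ k) ` {..<N}) = card {..<N}"
    using card_a N_eq by (simp add: card_Diff_singleton)
qed simp

lemma beta_eq_iff: "\<beta> ^ i = \<beta> ^ j \<longleftrightarrow> i mod N = j mod N"
  using inj_onD[OF beta_inj, of "i mod N" "j mod N"] beta_mod[of i] beta_mod[of j] N_pos by auto

text \<open>Exponents are determined modulo \<open>N\<close>, and \<open>4\<close> divides
  \<open>N\<close>; squares, fourth powers and their coset can thus be recognised by the exponent
  modulo 4.\<close>

lemma beta_eq_mod4: "\<beta> ^ i = \<beta> ^ j \<Longrightarrow> i mod 4 = j mod 4"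
  unfolding beta_eq_iff using four_N by (metis mod_mod_cancel)

lemma square_iff: "\<beta> ^ k \<in> {z ^ 2 |z. z \<noteq> 0} \<longleftrightarrow> even k"
proof
  assume "\<beta> ^ k \<in> {z ^ 2 |z. z \<noteq> 0}"
  then obtain j where "\<beta> ^ k = (\<beta> ^ j) ^ 2" using powers by auto
  then have "k mod 4 = (j * 2) mod 4" by (intro beta_eq_mod4) (simp add: power_mult)
  then show "even k" by presburger
next
  assume "even k"
  then obtain j where "k = j * 2" by (metis dvd_div_mult_self)
  then show "\<beta> ^ k \<in> {z ^ 2 |z. z \<noteq> 0}" using beta_nonzero by (auto simp: power_mult intro!: exI[of _ "\<beta> ^ j"])
qed

lemma fourth_power_iff: "\<beta> ^ k \<in> fourth_powers \<longleftrightarrow> k mod 4 = 0"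
proof
  assume "\<beta> ^ k \<in> fourth_powers"
  then obtain j where "\<beta> ^ k = (\<beta> ^ j) ^ 4" using powers by (auto simp: fourth_powers_def)
  then have "k mod 4 = (j * 4) mod 4" by (intro beta_eq_mod4) (simp add: power_mult)
  then show "k mod 4 = 0" by simp
next
  assume "k mod 4 = 0"
  then have "k = k div 4 * 4" by presburger
  then obtain j where "k = j * 4" by blast
  then show "\<beta> ^ k \<in> fourth_powers" using beta_nonzero by (auto simp: power_mult fourth_powers_def intro!: exI[of _ "\<beta> ^ j"])
qed

lemma coset_iff: "\<beta> ^ k \<in> (\<lambda>c. \<beta> * c) ` fourth_powers \<longleftrightarrow> k mod 4 = 1"
proof
  assume "\<beta> ^ k \<in> (\<lambda>c. \<beta> * c) ` fourth_powers"
  then obtain z where "z \<noteq> 0" "\<beta> ^ k = \<beta> * z ^ 4" by (auto simp: fourth_powers_def)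
  then obtain j where "\<beta> ^ k = \<beta> * (\<beta> ^ j) ^ 4" using powers by metis
  then have "k mod 4 = (1 + j * 4) mod 4" by (intro beta_eq_mod4) (simp add: power_mult)
  then show "k mod 4 = 1" by presburger
next
  assume k: "k mod 4 = 1"
  then have "k = Suc (4 * (k div 4))" by presburger
  then have "\<beta> ^ k = \<beta> * \<beta> ^ (4 * (k div 4))" by (metis power_Suc)
  then show "\<beta> ^ k \<in> (\<lambda>c. \<beta> * c) ` fourth_powers" using fourth_power_iff[of "4 * (k div 4)"] by auto
qed

text \<open>All slopes are powers of \<open>\<beta> ^ (p - 1)\<close>, an element of order
  \<open>p + 1\<close>; \<open>S\<close> lists the exponents selected.\<close>

definition dirs :: "nat set \<Rightarrow> 'a set" where
  "dirs S = (\<lambda>j. \<beta> ^ ((p - 1) * j)) ` S"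

text \<open>For multiples of \<open>p - 1\<close>, equality modulo
  \<open>N = (p - 1) * (p + 1)\<close> is equality of the cofactors modulo
  \<open>p + 1\<close>.\<close>

lemma power_mem_dirs:
  assumes "S \<subseteq> {..<p + 1}"
  shows "(\<beta> ^ k) ^ (p - 1) \<in> dirs S \<longleftrightarrow> k mod (p + 1) \<in> S"
proof -
  have "(\<beta> ^ k) ^ (p - 1) = \<beta> ^ ((p - 1) * j) \<longleftrightarrow> k mod (p + 1) = j" if "j \<in> S" for j
  proof -
    have "(\<beta> ^ k) ^ (p - 1) = \<beta> ^ ((p - 1) * k)" by (simp add: power_mult[symmetric] mult.commute)
    then have "(\<beta> ^ k) ^ (p - 1) = \<beta> ^ ((p - 1) * j) \<longleftrightarrow> (p - 1) * k mod N = (p - 1) * j mod N"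
      by (simp only: beta_eq_iff)
    also have "\<dots> \<longleftrightarrow> k mod (p + 1) = j mod (p + 1)"
      unfolding N_def mult_mod_right[symmetric] using p1 by simp
    also have "j mod (p + 1) = j" using assms that by auto
    finally show ?thesis .
  qed
  then show ?thesis unfolding dirs_def by auto
qed

lemma direction_set_dirs:
  assumes "S \<subseteq> {..<p + 1}" and "card S = 2 * n"
  shows "direction_set p (2 * n) (dirs S)"
proof
  show "prime p" "CARD('a) = p ^ 2" "p + 1 = 2 * (2 * n)" using prime_p card_a p_n by auto
  show "CHAR('a) = p" using prime_p card_a by (rule CHAR_prime_square)
  show "2 \<le> 2 * n" using p_n by (cases n) auto
  have "inj_on (\<lambda>j. \<beta> ^ ((p - 1) * j)) S"
  proof (rule inj_onI)
    fix i j assume ij: "i \<in> S" "j \<in> S" "\<beta> ^ ((p - 1) * i) = \<beta> ^ ((p - 1) * j)"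
    have lt: "(p - 1) * i < N" if "i \<in> S" for i
      unfolding N_def using that assms(1) p1 by (intro mult_strict_left_mono) auto
    have "(p - 1) * i = (p - 1) * j" using inj_onD[OF beta_inj ij(3)] lt ij by simp
    then show "i = j" using p1 by simp
  qed
  then show "card (dirs S) = 2 * n" using assms(2) by (simp add: dirs_def card_image)
  fix t assume "t \<in> dirs S"
  then obtain j where "t = \<beta> ^ ((p - 1) * j)" by (auto simp: dirs_def)
  then have "t ^ (p + 1) = (\<beta> ^ N) ^ j" by (simp only: power_mult[symmetric] N_def mult_ac)
  then show "t ^ (p + 1) = 1" by (simp add: beta_N)
qed

text \<open>Applicable to both graphs because \<open>4\<close> divides \<open>p + 1\<close>: the
  residue of an exponent modulo 4 is determined by its residue modulo \<open>p + 1\<close>.\<close>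

lemma adjacency_matrix_dirs:
  assumes S: "S \<subseteq> {..<p + 1}" "card S = 2 * n"
    and E: "\<And>x y k. x - y = \<beta> ^ k \<Longrightarrow> E x y \<longleftrightarrow> k mod (p + 1) \<in> S" and irr: "\<And>x. \<not> E x x"
  shows "adjacency_matrix E = redm (direction_set.adj p (dirs S))"
proof -
  interpret direction_set p "2 * n" "dirs S" using S by (rule direction_set_dirs)
  have "E x y \<longleftrightarrow> x \<noteq> y \<and> (x - y) ^ (p - 1) \<in> dirs S" for x y
  proof (cases "x = y")
    case False
    then obtain k where k: "x - y = \<beta> ^ k" using powers[of "x - y"] by auto
    show ?thesis using False E[OF k] power_mem_dirs[OF S(1), of k] by (simp add: k)
  qed (simp add: irr)
  then show ?thesis by (simp add: adjacency_matrix_def redm_def adj_def vec_eq_iff)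
qed

section \<open>Exponent sets of the two graphs\<close>

definition paley_exps :: "nat set" where
  "paley_exps = {j. j < p + 1 \<and> even j}"

definition peisert_exps :: "nat set" where
  "peisert_exps = {j. j < p + 1 \<and> (j mod 4 = 0 \<or> j mod 4 = 1)}"

lemma card_paley_exps: "card paley_exps = 2 * n"
proof -
  have "paley_exps = (\<lambda>i. 2 * i) ` {..<2 * n}"
    using p_n by (auto simp: paley_exps_def elim!: evenE)
  then show ?thesis by (simp add: card_image inj_on_def)
qed

lemma card_peisert_exps: "card peisert_exps = 2 * n"
proof -
  have "peisert_exps = (\<lambda>i. 4 * i) ` {..<n} \<union> (\<lambda>i. 4 * i + 1) ` {..<n}"
  proof (rule set_eqI)
    fix j
    have "j < 4 * n \<longleftrightarrow> j div 4 < n" by (metis less_mult_imp_div_less div_less_iff_less_mult mult.commute zero_less_numeral)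
    moreover have "j mod 4 = 0 \<longleftrightarrow> j = 4 * (j div 4)" "j mod 4 = 1 \<longleftrightarrow> j = 4 * (j div 4) + 1" by presburger+
    ultimately show "j \<in> peisert_exps \<longleftrightarrow> j \<in> (\<lambda>i. 4 * i) ` {..<n} \<union> (\<lambda>i. 4 * i + 1) ` {..<n}"
      unfolding peisert_exps_def p_n by auto
  qed
  moreover have "card ((\<lambda>i. 4 * i) ` {..<n} \<union> (\<lambda>i. 4 * i + 1) ` {..<n}) = n + n"
    by (subst card_Un_disjoint) (auto simp: card_image inj_on_def, presburger)
  ultimately show ?thesis by simp
qed

lemma paley_matrix: "adjacency_matrix (paley_adj :: 'a \<Rightarrow> _) = redm (direction_set.adj p (dirs paley_exps))"
proof (rule adjacency_matrix_dirs)
  show "paley_exps \<subseteq> {..<p + 1}" by (auto simp: paley_exps_def)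
  fix x y :: 'a and k assume k: "x - y = \<beta> ^ k"
  then have "x \<noteq> y" using beta_nonzero by auto
  then have "paley_adj x y \<longleftrightarrow> even k" unfolding paley_adj_def k square_iff by simp
  also have "\<dots> \<longleftrightarrow> even (k mod (p + 1))" unfolding p_n by (simp add: dvd_mod_iff)
  finally show "paley_adj x y \<longleftrightarrow> k mod (p + 1) \<in> paley_exps" by (simp add: paley_exps_def)
qed (auto simp: card_paley_exps paley_adj_def)

lemma peisert_matrix: "adjacency_matrix (peisert_adj \<beta>) = redm (direction_set.adj p (dirs peisert_exps))"
proof (rule adjacency_matrix_dirs)
  show "peisert_exps \<subseteq> {..<p + 1}" by (auto simp: peisert_exps_def)
  fix x y :: 'a and k assume k: "x - y = \<beta> ^ k"
  then have "x \<noteq> y" using beta_nonzero by auto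
  then have "peisert_adj \<beta> x y \<longleftrightarrow> k mod 4 = 0 \<or> k mod 4 = 1"
    unfolding peisert_adj_def k Un_iff fourth_power_iff coset_iff by simp
  also have "k mod 4 = k mod (p + 1) mod 4" unfolding p_n by (simp add: mod_mod_cancel)
  finally show "peisert_adj \<beta> x y \<longleftrightarrow> k mod (p + 1) \<in> peisert_exps" by (simp add: peisert_exps_def)
qed (auto simp: card_peisert_exps peisert_adj_def)

lemma similar_over_if_of_int:
  fixes D :: "'b::field set"
  assumes "range of_int \<subseteq> D"
  shows "similar_over D (adjacency_matrix (paley_adj :: 'a \<Rightarrow> _)) (adjacency_matrix (peisert_adj \<beta>))"
proof -
  have "direction_set p (2 * n) (dirs paley_exps)" "direction_set p (2 * n) (dirs peisert_exps)"
    by (auto intro!: direction_set_dirs simp: card_paley_exps card_peisert_exps)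
       (auto simp: paley_exps_def peisert_exps_def)
  from adj_similar[OF this] show ?thesis
    unfolding paley_matrix peisert_matrix using similar_over_if_similar_int[OF assms] by blast
qed

end

theorem theorem5p1:
  fixes p :: nat and \<beta> :: "'a::{field,finite}"
  assumes "prime p" and "p mod 4 = 3" and "CARD('a) = p ^ 2"
    and "primitive_element \<beta>"
  shows "(\<exists>K. number_field K \<and>
            similar_over (ring_of_integers K)
              (adjacency_matrix (paley_adj :: 'a \<Rightarrow> 'a \<Rightarrow> bool))
              (adjacency_matrix (peisert_adj \<beta>))) \<and>
         (\<forall>l::nat. prime l \<longrightarrow>
            similar_over (localized_integers l)
              (adjacency_matrix (paley_adj :: 'a \<Rightarrow> 'a \<Rightarrow> bool))
              (adjacency_matrix (peisert_adj \<beta>)))"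
proof -
  have "p + 1 = 4 * ((p + 1) div 4)" using assms(2) by presburger
  then interpret primitive_setting p "(p + 1) div 4" \<beta>
    using assms by unfold_locales auto
  show ?thesis
    using number_field_Rats similar_over_if_of_int[OF of_int_ring_of_integers]
      similar_over_if_of_int[OF of_int_localized_integers] by blast
qed

end
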